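(* Let $S_{\underline\lambda}$ be a contractive weighted shift with positive weights on a directed tree $\mathcal{T}$, and suppose $S_{\underline\lambda}$ is of class $C_{1\cdot}$. (i) If $\mathcal{T}$ has a root, then $S_{\underline\lambda}^*$ is cyclic. (ii) If $\mathcal{T}$ is rootless and $\operatorname{Br}(\mathcal{T})<\infty$, then $S_{\underline\lambda}^*$ is cyclic.
   Context: A directed tree $\mathcal{T}=(V,E)$ is a connected directed graph without loops or directed circuits in which each vertex has at most one parent; $\operatorname{Chi}(u)=\{v:(u,v)\in E\}$; a root is a vertex without a parent; a leaf has no children; $\operatorname{Br}(\mathcal{T})=\sum_{u\text{ not a leaf}}(\#\operatorname{Chi}(u)-1)$. For weights $\lambda_v>0$ ($v$ not the root) with $\sup_u\sum_{v\in\operatorname{Chi}(u)}\lambda_v^2<\infty$, $S_{\underline\lambda}e_u=\sum_{v\in\operatorname{Chi}(u)}\lambda_ve_v$ on $\ell^2(V)$. A contraction $T$ is of class $C_{1\cdot}$ if $\|T^nx\|\not\to0$ for every $x\neq0$. An operator is cyclic if some vector's orbit has dense linear span. *)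

theory Defs
  imports "HOL-Analysis.Analysis" "HOL-Library.Extended_Nat"
begin

definition directed_tree :: "'a set \<Rightarrow> ('a \<times> 'a) set \<Rightarrow> bool" where
  "directed_tree V E \<longleftrightarrow>
     V \<noteq> {} \<and> E \<subseteq> V \<times> V
     \<and> (\<forall>u v. (u, v) \<in> (E \<union> E\<inverse>)\<^sup>* \<or> u \<notin> V \<or> v \<notin> V)
     \<and> (\<forall>u. (u, u) \<notin> E)
     \<and> (\<forall>u. (u, u) \<notin> E\<^sup>+)
     \<and> (\<forall>u1 u2 v. (u1, v) \<in> E \<longrightarrow> (u2, v) \<in> E \<longrightarrow> u1 = u2)"

definition Chi :: "('a \<times> 'a) set \<Rightarrow> 'a \<Rightarrow> 'a set" where
  "Chi E u = {v. (u, v) \<in> E}"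

definition has_parent :: "('a \<times> 'a) set \<Rightarrow> 'a \<Rightarrow> bool" where
  "has_parent E v \<longleftrightarrow> (\<exists>u. (u, v) \<in> E)"

definition par :: "('a \<times> 'a) set \<Rightarrow> 'a \<Rightarrow> 'a" where
  "par E v = (THE u. (u, v) \<in> E)"

definition is_root :: "'a set \<Rightarrow> ('a \<times> 'a) set \<Rightarrow> 'a \<Rightarrow> bool" where
  "is_root V E u \<longleftrightarrow> u \<in> V \<and> \<not> has_parent E u"

definition has_root :: "'a set \<Rightarrow> ('a \<times> 'a) set \<Rightarrow> bool" where
  "has_root V E \<longleftrightarrow> (\<exists>u. is_root V E u)"

definition is_leaf :: "('a \<times> 'a) set \<Rightarrow> 'a \<Rightarrow> bool" where
  "is_leaf E u \<longleftrightarrow> Chi E u = {}"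

definition ecard :: "'a set \<Rightarrow> enat" where
  "ecard A = (if finite A then enat (card A) else \<infinity>)"

definition Br :: "'a set \<Rightarrow> ('a \<times> 'a) set \<Rightarrow> enat" where
  "Br V E = (SUP F \<in> {F. finite F \<and> F \<subseteq> {u \<in> V. \<not> is_leaf E u}}.
                \<Sum>u\<in>F. ecard (Chi E u) - 1)"

definition l2 :: "'a set \<Rightarrow> ('a \<Rightarrow> complex) set" where
  "l2 V = {f. (\<forall>x. x \<notin> V \<longrightarrow> f x = 0) \<and> (\<lambda>x. (cmod (f x))\<^sup>2) summable_on V}"

definition l2_inner :: "'a set \<Rightarrow> ('a \<Rightarrow> complex) \<Rightarrow> ('a \<Rightarrow> complex) \<Rightarrow> complex" where
  "l2_inner V f g = (\<Sum>\<^sub>\<infinity>x\<in>V. f x * cnj (g x))"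

definition l2_norm :: "'a set \<Rightarrow> ('a \<Rightarrow> complex) \<Rightarrow> real" where
  "l2_norm V f = sqrt (\<Sum>\<^sub>\<infinity>x\<in>V. (cmod (f x))\<^sup>2)"

text \<open>\<open>S_\<lambda> e_u = \<Sum>_{v \<in> Chi u} \<lambda>_v e_v\<close>, i.e. \<open>(S_\<lambda> f)(v) = \<lambda>_v f(par v)\<close>
  for non-root v, and 0 at the root.\<close>
definition wshift :: "'a set \<Rightarrow> ('a \<times> 'a) set \<Rightarrow> ('a \<Rightarrow> real) \<Rightarrow> ('a \<Rightarrow> complex) \<Rightarrow> ('a \<Rightarrow> complex)" where
  "wshift V E lam f = (\<lambda>v. if v \<in> V \<and> has_parent E v then complex_of_real (lam v) * f (par E v) else 0)"

definition admissible_weights :: "'a set \<Rightarrow> ('a \<times> 'a) set \<Rightarrow> ('a \<Rightarrow> real) \<Rightarrow> bool" where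
  "admissible_weights V E lam \<longleftrightarrow>
     (\<forall>v\<in>V. has_parent E v \<longrightarrow> lam v > 0)
     \<and> (\<exists>M. \<forall>u\<in>V. (\<lambda>v. (lam v)\<^sup>2) summable_on Chi E u \<and> (\<Sum>\<^sub>\<infinity>v\<in>Chi E u. (lam v)\<^sup>2) \<le> M)"

definition is_contraction :: "'a set \<Rightarrow> (('a \<Rightarrow> complex) \<Rightarrow> ('a \<Rightarrow> complex)) \<Rightarrow> bool" where
  "is_contraction V T \<longleftrightarrow> (\<forall>f\<in>l2 V. T f \<in> l2 V \<and> l2_norm V (T f) \<le> l2_norm V f)"

definition class_C1dot :: "'a set \<Rightarrow> (('a \<Rightarrow> complex) \<Rightarrow> ('a \<Rightarrow> complex)) \<Rightarrow> bool" where
  "class_C1dot V T \<longleftrightarrow> is_contraction V T \<and>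
     (\<forall>f\<in>l2 V. f \<noteq> (\<lambda>_. 0) \<longrightarrow> \<not> ((\<lambda>n. l2_norm V ((T ^^ n) f)) \<longlonglongrightarrow> 0))"

definition is_adjoint :: "'a set \<Rightarrow> (('a \<Rightarrow> complex) \<Rightarrow> ('a \<Rightarrow> complex))
     \<Rightarrow> (('a \<Rightarrow> complex) \<Rightarrow> ('a \<Rightarrow> complex)) \<Rightarrow> bool" where
  "is_adjoint V T T' \<longleftrightarrow> (\<forall>g\<in>l2 V. T' g \<in> l2 V) \<and>
     (\<forall>f\<in>l2 V. \<forall>g\<in>l2 V. l2_inner V (T f) g = l2_inner V f (T' g))"

definition cyclic_op :: "'a set \<Rightarrow> (('a \<Rightarrow> complex) \<Rightarrow> ('a \<Rightarrow> complex)) \<Rightarrow> bool" where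
  "cyclic_op V T \<longleftrightarrow> (\<exists>x\<in>l2 V. \<forall>y\<in>l2 V. \<forall>\<epsilon>>0. \<exists>n (c :: nat \<Rightarrow> complex).
      l2_norm V (\<lambda>v. y v - (\<Sum>k<n. c k * (T ^^ k) x v)) < \<epsilon>)"

end

theory Submission
  imports Defs "HOL-Complex_Analysis.Complex_Analysis" "HOL-Library.Function_Algebras"
    "HOL-Computational_Algebra.Polynomial"
begin

text \<open>
  Let \<open>A\<close> be the adjoint of the weighted shift, so that \<open>A e\<^sub>v\<close> is a positive multiple of \<open>e\<^sub>u\<close> for
  the parent \<open>u\<close> of \<open>v\<close>. Class \<open>C\<^sub>1\<^sub>\<cdot>\<close> rules out leaves, so every \<open>e\<^sub>v\<close> has a preimage under each power
  of \<open>A\<close>. In a rooted tree every \<open>e\<^sub>v\<close> is also killed by some power of \<open>A\<close>, and an operator with dense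
  range and dense generalized kernel has a cyclic vector by Baire category.

  In a rootless tree with finite branching index there is a bi-infinite path that is eventually
  unbranched; by class \<open>C\<^sub>1\<^sub>\<cdot>\<close> the products of weights along it stay away from \<open>0\<close>. Scaled unit vectors
  \<open>g\<^sub>k\<close> on this path are bounded and satisfy \<open>A g\<^sub>k = g\<^sub>k\<^sub>-\<^sub>1\<close>, and every \<open>e\<^sub>v\<close> is a multiple of some
  \<open>g\<^sub>k\<close> plus a vector in the generalized kernel. Mapping Fourier coefficients to the \<open>g\<^sub>k\<close> turns
  multiplication by \<open>z\<close> on the circle into \<open>A\<close>, so the first summand is controlled by a cyclic vector of
  the bilateral shift: a function with a zero at \<open>1\<close> so flat that its logarithm is not integrable.
  The Baire argument takes care of the second summand.
\<close>

subsection \<open>The space of square summable families\<close>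

definition cscale :: "complex \<Rightarrow> ('a \<Rightarrow> complex) \<Rightarrow> 'a \<Rightarrow> complex" where
  "cscale c f = (\<lambda>v. c * f v)"

definition delta :: "'a \<Rightarrow> 'a \<Rightarrow> complex" where
  "delta u = (\<lambda>v. if v = u then 1 else 0)"

lemma cscale_apply [simp]: "cscale c f v = c * f v"
  by (simp add: cscale_def)

lemma cscale_simps [simp]:
  "cscale 1 f = f" "cscale 0 f = 0" "cscale c 0 = 0" "cscale c (cscale d f) = cscale (c * d) f"
  by (auto simp: fun_eq_iff)

lemma sum_apply: "(\<Sum>i\<in>I. f i) x = (\<Sum>i\<in>I. f i x :: 'b :: comm_monoid_add)"
  by (induction I rule: infinite_finite_induct) auto

lemma cscale_add_right: "cscale c (f + g) = cscale c f + cscale c g"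
  by (auto simp: fun_eq_iff algebra_simps)

lemma L2_set_le_l2_norm:
  assumes "f \<in> l2 V" "finite F" "F \<subseteq> V"
  shows "L2_set (\<lambda>v. cmod (f v)) F \<le> l2_norm V f"
  using assms unfolding L2_set_def l2_norm_def l2_def
  by (auto intro!: finite_sum_le_infsum)

text \<open>Both membership and the norm are determined by finite sections, so later norm estimates
  only handle finite sums, where \<open>L2_set\<close> supplies Minkowski's inequality.\<close>

lemma l2_boundI:
  assumes "\<And>v. v \<notin> V \<Longrightarrow> f v = 0" "0 \<le> C"
    and "\<And>F. finite F \<Longrightarrow> F \<subseteq> V \<Longrightarrow> L2_set (\<lambda>v. cmod (f v)) F \<le> C"
  shows "f \<in> l2 V \<and> l2_norm V f \<le> C"
proof -
  have le: "(\<Sum>v\<in>F. (cmod (f v))\<^sup>2) \<le> C\<^sup>2" if "finite F" "F \<subseteq> V" for F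
    using assms(3)[OF that] unfolding L2_set_def
    by (smt (verit) real_sqrt_le_iff real_sqrt_unique assms(2))
  have s: "(\<lambda>v. (cmod (f v))\<^sup>2) summable_on V"
    by (rule nonneg_bdd_above_summable_on) (auto simp: bdd_above_def intro!: exI[of _ "C\<^sup>2"] le)
  have "(\<Sum>\<^sub>\<infinity>v\<in>V. (cmod (f v))\<^sup>2) \<le> C\<^sup>2"
    by (rule infsum_le_finite_sums[OF s le])
  hence "l2_norm V f \<le> C"
    unfolding l2_norm_def using assms(2) by (simp add: real_le_lsqrt)
  with s assms(1) show ?thesis by (auto simp: l2_def)
qed

lemma l2_vanish: "f \<in> l2 V \<Longrightarrow> v \<notin> V \<Longrightarrow> f v = 0"
  by (simp add: l2_def)

lemma l2_norm_nonneg [simp]: "0 \<le> l2_norm V f"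
  by (simp add: l2_norm_def infsum_nonneg)

lemma l2_add:
  assumes f: "f \<in> l2 V" and g: "g \<in> l2 V"
  shows "f + g \<in> l2 V" "l2_norm V (f + g) \<le> l2_norm V f + l2_norm V g"
proof -
  have "f + g \<in> l2 V \<and> l2_norm V (f + g) \<le> l2_norm V f + l2_norm V g"
  proof (rule l2_boundI)
    fix F assume F: "finite F" "F \<subseteq> V"
    have "L2_set (\<lambda>v. cmod ((f + g) v)) F \<le> L2_set (\<lambda>v. cmod (f v) + cmod (g v)) F"
      by (intro L2_set_mono) (auto intro: norm_triangle_ineq)
    also have "\<dots> \<le> L2_set (\<lambda>v. cmod (f v)) F + L2_set (\<lambda>v. cmod (g v)) F"
      by (rule L2_set_triangle_ineq)
    also have "\<dots> \<le> l2_norm V f + l2_norm V g"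
      by (intro add_mono L2_set_le_l2_norm f g F)
    finally show "L2_set (\<lambda>v. cmod ((f + g) v)) F \<le> l2_norm V f + l2_norm V g" .
  qed (auto simp: l2_vanish[OF f] l2_vanish[OF g])
  thus "f + g \<in> l2 V" "l2_norm V (f + g) \<le> l2_norm V f + l2_norm V g" by auto
qed

lemma l2_norm_cscale: "l2_norm V (cscale c f) = cmod c * l2_norm V f"
  by (simp add: l2_norm_def norm_mult power_mult_distrib infsum_cmult_right' real_sqrt_mult)

lemma l2_cscale: "f \<in> l2 V \<Longrightarrow> cscale c f \<in> l2 V"
  by (auto simp: l2_def norm_mult power_mult_distrib intro: summable_on_cmult_right)

lemma l2_zero: "0 \<in> l2 V" "l2_norm V 0 = 0"
  by (auto simp: l2_def l2_norm_def)

lemma uminus_eq_cscale: "- f = cscale (-1) f"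
  by (auto simp: fun_eq_iff)

lemma l2_uminus: "f \<in> l2 V \<Longrightarrow> - f \<in> l2 V" "l2_norm V (- f) = l2_norm V f"
  by (auto simp: uminus_eq_cscale l2_cscale l2_norm_cscale)

lemma l2_diff:
  assumes "f \<in> l2 V" "g \<in> l2 V"
  shows "f - g \<in> l2 V" "l2_norm V (f - g) \<le> l2_norm V f + l2_norm V g"
  using l2_add[OF assms(1) l2_uminus(1)[OF assms(2)]] by (auto simp: l2_uminus)

lemma l2_norm_minus_commute: "l2_norm V (f - g) = l2_norm V (g - f)"
  by (metis l2_uminus(2) minus_diff_eq)

lemma l2_norm_triangle:
  assumes "f \<in> l2 V" "g \<in> l2 V" "h \<in> l2 V"
  shows "l2_norm V (f - h) \<le> l2_norm V (f - g) + l2_norm V (g - h)"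
  using l2_add(2)[OF l2_diff(1)[OF assms(1,2)] l2_diff(1)[OF assms(2,3)]] by simp

lemma cmod_le_l2_norm:
  assumes "f \<in> l2 V"
  shows "cmod (f v) \<le> l2_norm V f"
proof (cases "v \<in> V")
  case True
  then show ?thesis using L2_set_le_l2_norm[OF assms, of "{v}"] by simp
qed (use assms in \<open>auto simp: l2_vanish\<close>)

lemma l2_norm_eq_0: "f \<in> l2 V \<Longrightarrow> l2_norm V f = 0 \<longleftrightarrow> f = 0"
  using cmod_le_l2_norm[of f V] by (force simp: fun_eq_iff l2_zero(2)[unfolded zero_fun_def] l2_norm_def)

lemma delta_l2: "u \<in> V \<Longrightarrow> delta u \<in> l2 V"
  and l2_norm_delta: "u \<in> V \<Longrightarrow> l2_norm V (delta u) = 1"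
proof -
  assume u: "u \<in> V"
  have L: "L2_set (\<lambda>v. cmod (delta u v)) F \<le> 1" if "finite F" for F
  proof -
    have "(\<Sum>v\<in>F. (cmod (delta u v))\<^sup>2) = (\<Sum>v\<in>F. if v = u then 1 else 0)"
      by (intro sum.cong) (auto simp: delta_def)
    also have "\<dots> \<le> 1" using that by simp
    finally show ?thesis by (simp add: L2_set_def)
  qed
  have *: "delta u \<in> l2 V \<and> l2_norm V (delta u) \<le> 1"
    by (rule l2_boundI) (use u L in \<open>auto simp: delta_def\<close>)
  thus "delta u \<in> l2 V" ..
  with cmod_le_l2_norm[of "delta u" V u] * show "l2_norm V (delta u) = 1"
    by (simp add: delta_def)
qed

text \<open>Coordinates are dominated by the norm, so a Cauchy sequence converges pointwise; the
  pointwise limit is then shown to be the limit in norm.\<close>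

lemma l2_complete:
  assumes f: "\<And>n::nat. f n \<in> l2 V"
    and cauchy: "\<And>\<epsilon>. \<epsilon> > 0 \<Longrightarrow> \<exists>N. \<forall>m\<ge>N. \<forall>n\<ge>N. l2_norm V (f m - f n) < \<epsilon>"
  shows "\<exists>g\<in>l2 V. (\<lambda>n. l2_norm V (f n - g)) \<longlonglongrightarrow> 0"
proof -
  have "Cauchy (\<lambda>n. f n v)" for v
  proof (rule CauchyI)
    fix e :: real assume "e > 0"
    then obtain N where N: "\<forall>m\<ge>N. \<forall>n\<ge>N. l2_norm V (f m - f n) < e" using cauchy by blast
    have "cmod (f m v - f n v) < e" if "m \<ge> N" "n \<ge> N" for m n
      using cmod_le_l2_norm[OF l2_diff(1)[OF f f], of m n v] N that by fastforce
    thus "\<exists>M. \<forall>m\<ge>M. \<forall>n\<ge>M. cmod (f m v - f n v) < e" by blast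
  qed
  then obtain g where g: "(\<lambda>n. f n v) \<longlonglongrightarrow> g v" for v
    unfolding Cauchy_convergent_iff convergent_def by metis
  have g0: "g v = 0" if "v \<notin> V" for v
    using g[of v] l2_vanish[OF f that] by (simp add: LIMSEQ_const_iff)
  \<comment> \<open>Letting \<open>n\<close> grow on each finite section turns the Cauchy estimate
    into one against the pointwise limit.\<close>
  have bound: "f m - g \<in> l2 V \<and> l2_norm V (f m - g) \<le> \<epsilon>"
    if "\<epsilon> > 0" and N: "\<forall>m\<ge>N. \<forall>n\<ge>N. l2_norm V (f m - f n) < \<epsilon>" and "m \<ge> N" for \<epsilon> N m
  proof (rule l2_boundI)
    fix F assume F: "finite F" "F \<subseteq> V"
    have lim: "(\<lambda>n. L2_set (\<lambda>v. cmod ((f m - f n) v)) F) \<longlonglongrightarrow> L2_set (\<lambda>v. cmod ((f m - g) v)) F"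
      unfolding L2_set_def by (auto intro!: tendsto_intros g)
    show "L2_set (\<lambda>v. cmod ((f m - g) v)) F \<le> \<epsilon>"
    proof (rule LIMSEQ_le_const2[OF lim], intro exI allI impI)
      fix n assume "N \<le> n"
      have "L2_set (\<lambda>v. cmod ((f m - f n) v)) F \<le> l2_norm V (f m - f n)"
        by (intro L2_set_le_l2_norm l2_diff f F)
      also have "\<dots> \<le> \<epsilon>" using N \<open>N \<le> n\<close> \<open>m \<ge> N\<close> by (simp add: less_imp_le)
      finally show "L2_set (\<lambda>v. cmod ((f m - f n) v)) F \<le> \<epsilon>" .
    qed
  qed (use that g0 l2_vanish[OF f] in auto)
  have "g \<in> l2 V"
  proof -
    obtain N where "\<forall>m\<ge>N. \<forall>n\<ge>N. l2_norm V (f m - f n) < 1" using cauchy[of 1] by auto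
    hence "f N - g \<in> l2 V" using bound[of 1 N N] by auto
    hence "f N - (f N - g) \<in> l2 V" by (rule l2_diff(1)[OF f])
    thus ?thesis by (simp add: algebra_simps)
  qed
  moreover have "(\<lambda>n. l2_norm V (f n - g)) \<longlonglongrightarrow> 0"
  proof (rule LIMSEQ_I)
    fix r :: real assume "r > 0"
    then obtain N where "\<forall>m\<ge>N. \<forall>n\<ge>N. l2_norm V (f m - f n) < r/2" using cauchy[of "r/2"] by auto
    hence "l2_norm V (f n - g) \<le> r/2" if "n \<ge> N" for n using bound[of "r/2" N n] \<open>r > 0\<close> that by auto
    thus "\<exists>no. \<forall>n\<ge>no. norm (l2_norm V (f n - g) - 0) < r"
      using \<open>r > 0\<close> by (intro exI[of _ N]) (fastforce simp: abs_of_nonneg)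
  qed
  ultimately show ?thesis by blast
qed

text \<open>Truncating \<open>f\<close> to \<open>F\<close> leaves the tail of a convergent sum of
  squares.\<close>

lemma l2_finite_support_approx:
  assumes f: "f \<in> l2 V" and "\<epsilon> > 0"
  shows "\<exists>F. finite F \<and> F \<subseteq> V \<and> l2_norm V (f - (\<Sum>v\<in>F. cscale (f v) (delta v))) < \<epsilon>"
proof -
  let ?a = "\<lambda>v. (cmod (f v))\<^sup>2"
  have s: "?a summable_on V" using f by (simp add: l2_def)
  hence "(sum ?a \<longlongrightarrow> infsum ?a V) (finite_subsets_at_top V)"
    by (rule infsum_tendsto)
  hence "\<forall>\<^sub>F F in finite_subsets_at_top V. dist (sum ?a F) (infsum ?a V) < (\<epsilon>/2)\<^sup>2"
    by (rule tendstoD) (use assms in simp)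
  then obtain F where F: "finite F" "F \<subseteq> V" "dist (sum ?a F) (infsum ?a V) < (\<epsilon>/2)\<^sup>2"
    by (auto simp: eventually_finite_subsets_at_top)
  have val: "(f - (\<Sum>v\<in>F. cscale (f v) (delta v))) x = (if x \<in> F then 0 else f x)" for x
  proof -
    have "(\<Sum>v\<in>F. cscale (f v) (delta v)) x = (\<Sum>v\<in>F. if v = x then f x else 0)"
      unfolding sum_apply by (intro sum.cong) (auto simp: delta_def)
    thus ?thesis using F by simp
  qed
  have "f - (\<Sum>v\<in>F. cscale (f v) (delta v)) \<in> l2 V \<and> l2_norm V (f - (\<Sum>v\<in>F. cscale (f v) (delta v))) \<le> \<epsilon>/2"
  proof (rule l2_boundI)
    fix H assume H: "finite H" "H \<subseteq> V"
    have "(\<Sum>v\<in>H. (cmod ((f - (\<Sum>v\<in>F. cscale (f v) (delta v))) v))\<^sup>2) = (\<Sum>v\<in>H. if v \<in> F then 0 else ?a v)"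
      by (intro sum.cong) (auto simp only: val split: if_splits, auto)
    also have "\<dots> = sum ?a (H - F)"
      using H by (intro sum.mono_neutral_cong_right) auto
    also have "\<dots> = sum ?a (H \<union> F) - sum ?a F"
      using sum_diff[of "H \<union> F" F ?a] F H by (simp add: Un_Diff)
    also have "\<dots> \<le> infsum ?a V - sum ?a F"
      using finite_sum_le_infsum[OF s, of "H \<union> F"] F H by auto
    also have "\<dots> \<le> (\<epsilon>/2)\<^sup>2" using F(3) by (simp add: dist_real_def abs_less_iff)
    finally show "L2_set (\<lambda>v. cmod ((f - (\<Sum>v\<in>F. cscale (f v) (delta v))) v)) H \<le> \<epsilon>/2"
      unfolding L2_set_def using assms by (intro real_le_lsqrt) (auto intro: sum_nonneg)
  next
    fix v assume "v \<notin> V"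
    thus "(f - (\<Sum>v\<in>F. cscale (f v) (delta v))) v = 0" using l2_vanish[OF f] unfolding val by simp
  qed (use assms in simp)
  with F assms show ?thesis by (intro exI[of _ F]) auto
qed

subsection \<open>Operators on square summable families\<close>

text \<open>\<open>A\<close> is a function on all families, so boundedness and linearity are only
  demanded on \<open>l2 V\<close>.\<close>

locale l2_operator =
  fixes V :: "'a set" and A :: "('a \<Rightarrow> complex) \<Rightarrow> 'a \<Rightarrow> complex" and C :: real
  assumes C_nonneg: "0 \<le> C"
    and A_l2: "f \<in> l2 V \<Longrightarrow> A f \<in> l2 V"
    and A_bound: "f \<in> l2 V \<Longrightarrow> l2_norm V (A f) \<le> C * l2_norm V f"
    and A_add: "f \<in> l2 V \<Longrightarrow> g \<in> l2 V \<Longrightarrow> A (f + g) = A f + A g"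
    and A_cscale: "f \<in> l2 V \<Longrightarrow> A (cscale c f) = cscale c (A f)"
begin

lemma pow_l2: "f \<in> l2 V \<Longrightarrow> (A ^^ k) f \<in> l2 V"
  by (induction k) (auto intro: A_l2)

lemma pow_add: "f \<in> l2 V \<Longrightarrow> g \<in> l2 V \<Longrightarrow> (A ^^ k) (f + g) = (A ^^ k) f + (A ^^ k) g"
  by (induction k) (auto simp: A_add pow_l2)

lemma pow_cscale: "f \<in> l2 V \<Longrightarrow> (A ^^ k) (cscale c f) = cscale c ((A ^^ k) f)"
  by (induction k) (auto simp: A_cscale pow_l2)

lemma pow_zero: "(A ^^ k) 0 = 0"
  using pow_cscale[OF l2_zero(1), of k 0] by simp

lemma A_zero: "A 0 = 0"
  using A_cscale[OF l2_zero(1), of 0] by simp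

lemma pow_diff:
  assumes "f \<in> l2 V" "g \<in> l2 V"
  shows "(A ^^ k) (f - g) = (A ^^ k) f - (A ^^ k) g"
  using pow_add[OF l2_diff(1)[OF assms] assms(2), of k] by (simp add: eq_diff_eq)

lemma pow_eq_0_mono:
  assumes "(A ^^ m) f = 0" "m \<le> n"
  shows "(A ^^ n) f = 0"
proof -
  have "(A ^^ n) f = (A ^^ (n - m)) ((A ^^ m) f)"
    using assms(2) by (metis comp_apply funpow_add le_add_diff_inverse2)
  thus ?thesis using assms by (simp add: pow_zero)
qed

lemma sum_l2: "(\<And>i. i \<in> I \<Longrightarrow> f i \<in> l2 V) \<Longrightarrow> (\<Sum>i\<in>I. f i) \<in> l2 V"
  by (induction I rule: infinite_finite_induct) (auto intro: l2_zero l2_add)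

lemma pow_sum:
  "(\<And>i. i \<in> I \<Longrightarrow> f i \<in> l2 V) \<Longrightarrow> (A ^^ k) (\<Sum>i\<in>I. f i) = (\<Sum>i\<in>I. (A ^^ k) (f i))"
  by (induction I rule: infinite_finite_induct) (auto simp: pow_zero pow_add sum_l2)

section \<open>Polynomials in an operator\<close>

definition papp :: "complex poly \<Rightarrow> ('a \<Rightarrow> complex) \<Rightarrow> 'a \<Rightarrow> complex" where
  "papp p x = (\<Sum>k\<le>degree p. cscale (coeff p k) ((A ^^ k) x))"

text \<open>Polynomials of different degrees can be compared by summing over a common range.\<close>

lemma papp_lessThan:
  assumes "degree p < n"
  shows "papp p x = (\<Sum>k<n. cscale (coeff p k) ((A ^^ k) x))"
  unfolding papp_def using assms by (intro sum.mono_neutral_left) (auto simp: coeff_eq_0)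

lemma papp_0 [simp]: "papp 0 x = 0"
  by (simp add: papp_def)

lemma papp_poly_add: "papp (p + q) x = papp p x + papp q x"
proof -
  define n where "n = Suc (max (degree p) (degree q))"
  have d: "degree p < n" "degree q < n" "degree (p + q) < n"
    using degree_add_le_max[of p q] unfolding n_def by linarith+
  show ?thesis
    unfolding d[THEN papp_lessThan] sum.distrib[symmetric]
    by (intro sum.cong) (auto simp: fun_eq_iff algebra_simps)
qed

lemma papp_smult: "papp (smult c p) x = cscale c (papp p x)"
proof -
  have d: "degree p < Suc (degree p)" "degree (smult c p) < Suc (degree p)"
    using degree_smult_le[of c p] by auto
  show ?thesis
    unfolding d[THEN papp_lessThan]
    by (auto simp: fun_eq_iff sum_apply sum_distrib_left mult_ac simp del: sum.lessThan_Suc)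
qed

lemma papp_l2: "x \<in> l2 V \<Longrightarrow> papp p x \<in> l2 V"
  unfolding papp_def by (intro sum_l2 l2_cscale pow_l2)

lemma papp_pCons:
  assumes "x \<in> l2 V"
  shows "papp (pCons a p) x = cscale a x + A (papp p x)"
proof -
  have d: "degree (pCons a p) < Suc (Suc (degree p))" "degree p < Suc (degree p)"
    using degree_pCons_le[of a p] by auto
  have "A (papp p x) = (A ^^ 1) (papp p x)" by simp
  also have "\<dots> = (\<Sum>k<Suc (degree p). cscale (coeff p k) ((A ^^ Suc k) x))"
    unfolding papp_lessThan[OF d(2)] using assms
    by (subst pow_sum) (auto intro!: sum.cong simp: pow_l2 l2_cscale A_cscale simp del: sum.lessThan_Suc)
  finally have A: "A (papp p x) = (\<Sum>k<Suc (degree p). cscale (coeff p k) ((A ^^ Suc k) x))" .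
  show ?thesis unfolding A papp_lessThan[OF d(1)]
    by (subst sum.lessThan_Suc_shift) (simp del: sum.lessThan_Suc)
qed

lemma papp_mult: "x \<in> l2 V \<Longrightarrow> papp (p * q) x = papp p (papp q x)"
  by (induction p) (auto simp: papp_pCons papp_poly_add papp_smult papp_l2 A_zero)

lemma papp_monom: "x \<in> l2 V \<Longrightarrow> papp (monom c n) x = cscale c ((A ^^ n) x)"
  by (induction n) (auto simp: monom_0 monom_Suc papp_pCons A_cscale pow_l2 A_zero)

lemma papp_x_add: "x \<in> l2 V \<Longrightarrow> y \<in> l2 V \<Longrightarrow> papp p (x + y) = papp p x + papp p y"
  unfolding papp_def sum.distrib[symmetric] by (simp add: pow_add cscale_add_right)

lemma papp_x_diff:
  assumes "x \<in> l2 V" "y \<in> l2 V"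
  shows "papp p (x - y) = papp p x - papp p y"
  using papp_x_add[OF l2_diff(1)[OF assms] assms(2), of p] by (simp add: eq_diff_eq)

text \<open>Horner's scheme: passing from \<open>p\<close> to \<open>pCons a p\<close> replaces the
  bound \<open>L\<close> by \<open>cmod a + C * L\<close>.\<close>

lemma papp_bound: "\<exists>L\<ge>0. \<forall>x\<in>l2 V. l2_norm V (papp p x) \<le> L * l2_norm V x"
proof (induction p)
  case 0
  show ?case unfolding papp_0 l2_zero by (intro exI[of _ 0]) auto
next
  case (pCons a p)
  then obtain L where L: "L \<ge> 0" "\<And>x. x \<in> l2 V \<Longrightarrow> l2_norm V (papp p x) \<le> L * l2_norm V x" by auto
  show ?case
  proof (intro exI conjI ballI)
    show "0 \<le> cmod a + C * L" using L C_nonneg by simp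
    fix x assume x: "x \<in> l2 V"
    have "l2_norm V (papp (pCons a p) x) \<le> l2_norm V (cscale a x) + l2_norm V (A (papp p x))"
      unfolding papp_pCons[OF x] by (intro l2_add l2_cscale x A_l2 papp_l2)
    also have "\<dots> \<le> cmod a * l2_norm V x + C * (L * l2_norm V x)"
      using A_bound[OF papp_l2[OF x], of p] mult_left_mono[OF L(2)[OF x] C_nonneg]
      by (simp add: l2_norm_cscale)
    finally show "l2_norm V (papp (pCons a p) x) \<le> (cmod a + C * L) * l2_norm V x"
      by (simp add: algebra_simps)
  qed
qed

section \<open>The closed cyclic subspace generated by a vector\<close>

definition orbit_closure :: "('a \<Rightarrow> complex) \<Rightarrow> ('a \<Rightarrow> complex) set" where
  "orbit_closure x = {y \<in> l2 V. \<forall>\<epsilon>>0. \<exists>p. l2_norm V (y - papp p x) < \<epsilon>}"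

lemma orbit_closure_add:
  assumes x: "x \<in> l2 V" and "y \<in> orbit_closure x" "z \<in> orbit_closure x"
  shows "y + z \<in> orbit_closure x"
proof -
  have "\<exists>p. l2_norm V (y + z - papp p x) < \<epsilon>" if "\<epsilon> > 0" for \<epsilon>
  proof -
    obtain p q where "l2_norm V (y - papp p x) < \<epsilon>/2" "l2_norm V (z - papp q x) < \<epsilon>/2"
      using assms half_gt_zero[OF \<open>\<epsilon> > 0\<close>] unfolding orbit_closure_def by blast
    moreover have "l2_norm V ((y - papp p x) + (z - papp q x)) \<le> l2_norm V (y - papp p x) + l2_norm V (z - papp q x)"
      using assms by (intro l2_add l2_diff papp_l2) (auto simp: orbit_closure_def)
    ultimately show ?thesis
      by (intro exI[of _ "p + q"]) (simp add: papp_poly_add algebra_simps)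
  qed
  thus ?thesis using assms by (auto simp: orbit_closure_def intro: l2_add)
qed

lemma orbit_closure_cscale:
  assumes "y \<in> orbit_closure x"
  shows "cscale c y \<in> orbit_closure x"
proof -
  have "\<exists>p. l2_norm V (cscale c y - papp p x) < \<epsilon>" if "\<epsilon> > 0" for \<epsilon>
  proof -
    have "\<epsilon> / (cmod c + 1) > 0" using that by (intro divide_pos_pos) (auto simp: add_nonneg_pos)
    then obtain p where p: "l2_norm V (y - papp p x) < \<epsilon> / (cmod c + 1)"
      using assms unfolding orbit_closure_def by blast
    have "cscale c y - papp (smult c p) x = cscale c (y - papp p x)"
      unfolding papp_smult by (auto simp: fun_eq_iff algebra_simps)
    hence "l2_norm V (cscale c y - papp (smult c p) x) = cmod c * l2_norm V (y - papp p x)"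
      by (simp add: l2_norm_cscale)
    also have "\<dots> \<le> (cmod c + 1) * l2_norm V (y - papp p x)" by (intro mult_right_mono) auto
    also have "\<dots> < \<epsilon>" using p by (simp add: pos_less_divide_eq add_nonneg_pos mult.commute)
    finally show ?thesis by blast
  qed
  thus ?thesis using assms by (auto simp: orbit_closure_def intro: l2_cscale)
qed

lemma orbit_closure_papp: "x \<in> l2 V \<Longrightarrow> papp p x \<in> orbit_closure x"
  by (auto simp: orbit_closure_def papp_l2 l2_zero intro!: exI[of _ p])

text \<open>The orbit closure is closed under linear combinations, and finite combinations of the
  \<open>delta v\<close> are dense, so the unit vectors suffice.\<close>

lemma cyclic_opI:
  assumes x: "x \<in> l2 V" and d: "\<And>v. v \<in> V \<Longrightarrow> delta v \<in> orbit_closure x"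
  shows "cyclic_op V A"
  unfolding cyclic_op_def
proof (intro bexI[OF _ x] ballI allI impI)
  fix y \<epsilon> assume y: "y \<in> l2 V" and e: "(\<epsilon>::real) > 0"
  obtain F where F: "finite F" "F \<subseteq> V" "l2_norm V (y - (\<Sum>v\<in>F. cscale (y v) (delta v))) < \<epsilon>/2"
    using l2_finite_support_approx[OF y, of "\<epsilon>/2"] e by auto
  define z where "z = (\<Sum>v\<in>F. cscale (y v) (delta v))"
  have "z \<in> orbit_closure x"
    unfolding z_def using F(1,2)
    by (induction F rule: finite_induct)
       (auto intro: orbit_closure_add x orbit_closure_cscale d orbit_closure_papp[OF x, of 0, simplified])
  then obtain p where p: "l2_norm V (z - papp p x) < \<epsilon>/2" and z: "z \<in> l2 V"
    using half_gt_zero[OF e] unfolding orbit_closure_def by blast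
  have "l2_norm V (y - papp p x) < \<epsilon>"
    using l2_norm_triangle[OF y z papp_l2[OF x, of p]] p F(3) by (simp add: z_def)
  moreover have "y - papp p x = (\<lambda>v. y v - (\<Sum>k<Suc (degree p). coeff p k * (A ^^ k) x v))"
    by (subst papp_lessThan[OF lessI]) (auto simp: fun_eq_iff sum_apply simp del: sum.lessThan_Suc)
  ultimately show "\<exists>n c. l2_norm V (\<lambda>v. y v - (\<Sum>k<n. c k * (A ^^ k) x v)) < \<epsilon>"
    by (intro exI[of _ "Suc (degree p)"] exI[of _ "coeff p"]) simp
qed

section \<open>The generalized kernel and a criterion for cyclicity\<close>

definition gen_kernel :: "('a \<Rightarrow> complex) set" where
  "gen_kernel = {u \<in> l2 V. \<exists>n. (A ^^ n) u = 0}"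

lemma gen_kernel_add:
  assumes "u \<in> gen_kernel" "w \<in> gen_kernel"
  shows "u + w \<in> gen_kernel"
proof -
  obtain m n where "(A ^^ m) u = 0" "(A ^^ n) w = 0" and l: "u \<in> l2 V" "w \<in> l2 V"
    using assms by (auto simp: gen_kernel_def)
  hence "(A ^^ max m n) u = 0" "(A ^^ max m n) w = 0" by (auto intro: pow_eq_0_mono)
  hence "(A ^^ max m n) (u + w) = 0" using l by (simp add: pow_add)
  thus ?thesis using l unfolding gen_kernel_def by (blast intro: l2_add)
qed

lemma gen_kernel_cscale: "u \<in> gen_kernel \<Longrightarrow> cscale c u \<in> gen_kernel"
  by (auto simp: gen_kernel_def pow_cscale l2_cscale fun_eq_iff intro: exI)

lemma pow_papp: "x \<in> l2 V \<Longrightarrow> (A ^^ m) (papp p x) = papp p ((A ^^ m) x)"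
  using papp_mult[of x "monom 1 m" p] papp_mult[of x p "monom 1 m"]
  by (simp add: papp_monom papp_l2 mult.commute)

lemma papp_zero_right: "papp p 0 = 0"
  by (simp add: papp_def pow_zero)

text \<open>If \<open>x\<close> can be recovered approximately from the vectors
  \<open>A^m q(A) x\<close>, then applying \<open>p(A)\<close>, which is bounded and commutes with
  \<open>A^m\<close>, recovers \<open>p(A) x\<close> as well. This allows
  \<open>cyclic_criterion\<close> to steer the orbit by polynomials divisible by an arbitrary power
  of \<open>A\<close>.\<close>

lemma orbit_closure_shift:
  assumes x: "x \<in> l2 V"
    and h: "\<And>\<epsilon>. \<epsilon> > 0 \<Longrightarrow> \<exists>p. l2_norm V (x - (A ^^ m) (papp p x)) < \<epsilon>"
    and y: "y \<in> orbit_closure x" and "\<epsilon> > 0"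
  shows "\<exists>p. l2_norm V (y - (A ^^ m) (papp p x)) < \<epsilon>"
proof -
  obtain p where p: "l2_norm V (y - papp p x) < \<epsilon>/2" and yl: "y \<in> l2 V"
    using y half_gt_zero[OF \<open>\<epsilon> > 0\<close>] unfolding orbit_closure_def by blast
  obtain L where L: "L \<ge> 0" "\<And>x. x \<in> l2 V \<Longrightarrow> l2_norm V (papp p x) \<le> L * l2_norm V x"
    using papp_bound[of p] by blast
  \<comment> \<open>The bound \<open>L\<close> may be 0; \<open>L + 1\<close> is safe as a
    divisor.\<close>
  obtain q where q: "l2_norm V (x - (A ^^ m) (papp q x)) < \<epsilon> / (2 * (L + 1))"
    using h[of "\<epsilon> / (2 * (L + 1))"] L \<open>\<epsilon> > 0\<close> by auto
  have q_l2: "(A ^^ m) (papp q x) \<in> l2 V" by (intro pow_l2 papp_l2 x)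
  have eq: "(A ^^ m) (papp (p * q) x) = papp p ((A ^^ m) (papp q x))"
    by (simp add: papp_mult x pow_papp papp_l2)
  have "l2_norm V (papp p x - (A ^^ m) (papp (p * q) x)) = l2_norm V (papp p (x - (A ^^ m) (papp q x)))"
    unfolding eq by (subst papp_x_diff) (auto simp: x q_l2)
  also have "\<dots> \<le> L * l2_norm V (x - (A ^^ m) (papp q x))"
    by (intro L l2_diff x q_l2)
  also have "\<dots> \<le> (L + 1) * (\<epsilon> / (2 * (L + 1)))"
    using q L by (intro mult_mono) auto
  also have "\<dots> = \<epsilon>/2" using L by (simp add: field_simps)
  finally have "l2_norm V (papp p x - (A ^^ m) (papp (p * q) x)) \<le> \<epsilon>/2" .
  moreover have "l2_norm V (y - (A ^^ m) (papp (p * q) x))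
      \<le> l2_norm V (y - papp p x) + l2_norm V (papp p x - (A ^^ m) (papp (p * q) x))"
    by (intro l2_norm_triangle yl pow_l2 papp_l2 x)
  ultimately show ?thesis using p by (intro exI[of _ "p * q"]) linarith
qed

text \<open>A Baire category argument on the closure of \<open>xg + gen_kernel\<close>. A vector \<open>xg + u\<close> is perturbed
  to \<open>xg + u + \<delta> w\<close> with \<open>A\<^sup>N u = 0\<close> and \<open>A\<^sup>N w = yk\<close>; the polynomial \<open>A\<^sup>N / \<delta> + A\<^sup>N\<^sup>+\<^sup>M q(A)\<close>
  then maps it to \<open>yk\<close> plus a vector of the orbit of \<open>xg\<close> that can be steered to any \<open>yg\<close>.\<close>

lemma cyclic_criterion:
  assumes V: "countable V" and xg: "xg \<in> l2 V"
    and h: "\<And>m \<epsilon>. \<epsilon> > 0 \<Longrightarrow> \<exists>p. l2_norm V (xg - (A ^^ m) (papp p xg)) < \<epsilon>"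
    and decomp: "\<And>v. v \<in> V \<Longrightarrow> \<exists>yg yk. delta v = yg + yk \<and> yg \<in> orbit_closure xg \<and>
        yk \<in> gen_kernel \<and> (\<forall>N. \<exists>w\<in>l2 V. (A ^^ N) w = yk)"
  shows "cyclic_op V A"
proof -
  define M where "M = {x \<in> l2 V. \<forall>\<epsilon>>0. \<exists>u\<in>gen_kernel. l2_norm V (x - (xg + u)) < \<epsilon>}"
  define d where "d x y = l2_norm V (x - y)" for x y
  have M_l2: "x \<in> l2 V" if "x \<in> M" for x using that by (simp add: M_def)
  interpret Metric_space M d
    by standard (auto simp: d_def l2_norm_eq_0 l2_diff M_l2 intro: l2_norm_minus_commute l2_norm_triangle)
  have shifted: "xg + u \<in> M" if "u \<in> gen_kernel" for u
    using that xg unfolding M_def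
    by (auto simp: gen_kernel_def l2_zero intro: l2_add intro!: bexI[of _ u])
  have "mcomplete"
    unfolding mcomplete_def
  proof (intro allI impI)
    fix s assume s: "MCauchy s"
    hence sM: "s n \<in> M" for n by (auto simp: MCauchy_def)
    have "\<exists>g\<in>l2 V. (\<lambda>n. l2_norm V (s n - g)) \<longlonglongrightarrow> 0"
      using s sM M_l2 by (intro l2_complete) (auto simp: MCauchy_def d_def)
    then obtain g where g: "g \<in> l2 V" "(\<lambda>n. l2_norm V (s n - g)) \<longlonglongrightarrow> 0" by blast
    have ev: "\<forall>\<^sub>F n in sequentially. l2_norm V (s n - g) < \<epsilon>" if "\<epsilon> > 0" for \<epsilon>
      using order_tendstoD(2)[OF g(2) that] .
    \<comment> \<open>\<open>M\<close> is closed in \<open>l2 V\<close>, so the limit found there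
      already belongs to \<open>M\<close>.\<close>
    have "g \<in> M" unfolding M_def
    proof (safe intro!: g)
      fix \<epsilon> :: real assume "\<epsilon> > 0"
      then obtain n where n: "l2_norm V (s n - g) < \<epsilon>/2"
        using ev[of "\<epsilon>/2"] by (auto simp: eventually_sequentially)
      obtain u where u: "u \<in> gen_kernel" "l2_norm V (s n - (xg + u)) < \<epsilon>/2"
        using sM[of n] half_gt_zero[OF \<open>\<epsilon> > 0\<close>] unfolding M_def by blast
      have "l2_norm V (g - (xg + u)) \<le> l2_norm V (g - s n) + l2_norm V (s n - (xg + u))"
        by (intro l2_norm_triangle g M_l2 sM shifted u)
      thus "\<exists>u\<in>gen_kernel. l2_norm V (g - (xg + u)) < \<epsilon>"
        using n u l2_norm_minus_commute[of V g "s n"] by (intro bexI[of _ u]) auto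
    qed
    thus "\<exists>x. limitin mtopology s x sequentially"
      unfolding limitin_metric using sM ev by (intro exI[of _ g]) (auto simp: d_def)
  qed
  \<comment> \<open>A point of \<open>M\<close> lying in every \<open>G v n\<close> has all
    \<open>delta v\<close> in its orbit closure, hence is cyclic; it remains to see that each
    \<open>G v n\<close> is open and dense in \<open>M\<close>.\<close>
  define G where "G v n = {x \<in> M. \<exists>p. l2_norm V (delta v - papp p x) < 1 / real (Suc n)}" for v n
  have opn: "openin mtopology (G v n)" if v: "v \<in> V" for v n
    unfolding openin_mtopology
  proof (intro conjI allI impI)
    fix x assume "x \<in> G v n"
    then obtain p where x: "x \<in> M" and p: "l2_norm V (delta v - papp p x) < 1 / real (Suc n)"
      by (auto simp: G_def)
    obtain L where L: "L \<ge> 0" "\<And>x. x \<in> l2 V \<Longrightarrow> l2_norm V (papp p x) \<le> L * l2_norm V x"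
      using papp_bound[of p] by blast
    define r where "r = (1 / real (Suc n) - l2_norm V (delta v - papp p x)) / (L + 1)"
    have "r > 0" unfolding r_def using p L by (intro divide_pos_pos) auto
    have "y \<in> G v n" if "y \<in> mball x r" for y
    proof -
      have y: "y \<in> M" "l2_norm V (x - y) < r" using that by (auto simp: d_def)
      have "l2_norm V (papp p x - papp p y) \<le> L * l2_norm V (x - y)"
        using L(2)[OF l2_diff(1)[OF M_l2[OF x] M_l2[OF y(1)]]] by (simp add: papp_x_diff M_l2 x y)
      also have "\<dots> \<le> (L + 1) * l2_norm V (x - y)" by (intro mult_right_mono) auto
      also have "\<dots> < (L + 1) * r" using y L by (intro mult_strict_left_mono) auto
      also have "\<dots> = 1 / real (Suc n) - l2_norm V (delta v - papp p x)"
        unfolding r_def using L by (subst times_divide_eq_right, subst nonzero_mult_div_cancel_left) auto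
      finally have "l2_norm V (delta v - papp p x) + l2_norm V (papp p x - papp p y) < 1 / real (Suc n)"
        by simp
      moreover have "l2_norm V (delta v - papp p y) \<le> l2_norm V (delta v - papp p x) + l2_norm V (papp p x - papp p y)"
        by (intro l2_norm_triangle delta_l2 v papp_l2 M_l2 x y)
      ultimately show ?thesis using y unfolding G_def by (auto intro!: exI[of _ p])
    qed
    thus "\<exists>r>0. mball x r \<subseteq> G v n" using \<open>r > 0\<close> by blast
  qed (auto simp: G_def)
  have dense: "mtopology closure_of (G v n) = M" if v: "v \<in> V" for v n
  proof -
    have "\<exists>y\<in>G v n. y \<in> mball x r" if x: "x \<in> M" and "r > 0" for x r
    proof -
      obtain u where u: "u \<in> gen_kernel" "l2_norm V (x - (xg + u)) < r/2"
        using x half_gt_zero[OF \<open>r > 0\<close>] unfolding M_def by blast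
      then obtain N where N: "(A ^^ N) u = 0" and ul: "u \<in> l2 V" by (auto simp: gen_kernel_def)
      obtain yg yk where y: "delta v = yg + yk" "yg \<in> orbit_closure xg" "yk \<in> gen_kernel"
        "\<And>N. \<exists>w\<in>l2 V. (A ^^ N) w = yk" using decomp[OF v] by blast
      obtain K where K: "(A ^^ K) yk = 0" using y(3) by (auto simp: gen_kernel_def)
      obtain w where w: "w \<in> l2 V" "(A ^^ N) w = yk" using y(4) by blast
      have kw: "(A ^^ (K + N)) w = 0" using K w by (simp add: funpow_add)
      \<comment> \<open>The perturbation \<open>e w\<close> then has norm at most
        \<open>r/2\<close>; the \<open>+ 1\<close> covers \<open>w = 0\<close>.\<close>
      define e where "e = r / (2 * (l2_norm V w + 1))"
      have "e > 0" unfolding e_def using \<open>r > 0\<close> by (intro divide_pos_pos) (auto simp: add_nonneg_pos)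
      define t where "t = complex_of_real e"
      have t: "t \<noteq> 0" "cmod t = e" using \<open>e > 0\<close> by (auto simp: t_def)
      define x' where "x' = xg + (u + cscale t w)"
      have wk: "w \<in> gen_kernel" using w kw by (auto simp: gen_kernel_def)
      have x'M: "x' \<in> M"
        unfolding x'_def by (intro shifted gen_kernel_add u gen_kernel_cscale wk)
      have "l2_norm V (x - x') \<le> l2_norm V (x - (xg + u)) + l2_norm V (cscale t w)"
      proof -
        have eq: "x - x' = (x - (xg + u)) - cscale t w" by (simp add: x'_def algebra_simps)
        show ?thesis
          unfolding eq by (rule l2_diff(2)[OF l2_diff(1)[OF M_l2[OF x] M_l2[OF shifted[OF u(1)]]] l2_cscale[OF w(1)]])
      qed
      moreover have "l2_norm V (cscale t w) \<le> r/2"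
      proof -
        have "l2_norm V (cscale t w) \<le> e * (l2_norm V w + 1)"
          using t \<open>e > 0\<close> by (simp add: l2_norm_cscale)
        also have "\<dots> = r/2"
        proof -
          have "r / (2 * W) * W = r / 2" if "W > 0" for W :: real using that by simp
          from this[of "l2_norm V w + 1"] show ?thesis
            unfolding e_def using l2_norm_nonneg[of V w] by linarith
        qed
        finally show ?thesis .
      qed
      ultimately have near: "l2_norm V (x - x') < r" using u by linarith
      \<comment> \<open>Applying \<open>A^N / t\<close> to the summand \<open>xg\<close> produces an
        unwanted term. Subtracting it from the target \<open>yg\<close> stays in the orbit closure
        of \<open>xg\<close>, because the term is a polynomial in \<open>A\<close> applied to
        \<open>xg\<close>.\<close>
      define y' where "y' = yg - cscale (1/t) ((A ^^ N) xg)"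
      have "y' \<in> orbit_closure xg"
      proof -
        have "y' = yg + papp (monom (- (1/t)) N) xg"
          unfolding y'_def papp_monom[OF xg] by (auto simp: fun_eq_iff)
        thus ?thesis using orbit_closure_add[OF xg y(2) orbit_closure_papp[OF xg]] by simp
      qed
      then obtain q where q: "l2_norm V (y' - (A ^^ (K + N)) (papp q xg)) < 1 / real (Suc n)"
        using orbit_closure_shift[where m = "K + N" and \<epsilon> = "1 / real (Suc n)", OF xg h] by auto
      \<comment> \<open>Every term of \<open>p\<close> contains \<open>A^N\<close>, so
        \<open>u\<close> is killed. On \<open>t w\<close> the first term gives \<open>yk\<close>,
        and the second vanishes because \<open>A^(K + N) w = 0\<close>.\<close>
      define p where "p = monom (1/t) N + monom 1 (K + N) * q"
      have p: "papp p z = cscale (1/t) ((A ^^ N) z) + papp q ((A ^^ (K + N)) z)" if "z \<in> l2 V" for z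
        using that by (simp add: p_def papp_poly_add papp_monom papp_mult papp_l2 pow_papp)
      have "papp p x' = papp p xg + (papp p u + papp p (cscale t w))"
        unfolding x'_def by (simp add: papp_x_add xg ul w l2_cscale l2_add)
      also have "papp p u = 0"
        using N pow_eq_0_mono[OF N, of "K + N"] by (simp add: p ul papp_zero_right)
      also have "papp p (cscale t w) = yk"
        using w kw t by (simp add: p l2_cscale pow_cscale papp_zero_right)
      finally have "delta v - papp p x' = y' - (A ^^ (K + N)) (papp q xg)"
        unfolding y(1) y'_def p[OF xg] pow_papp[OF xg] by (auto simp: fun_eq_iff)
      hence "x' \<in> G v n" using q x'M unfolding G_def by (auto intro!: exI[of _ p])
      moreover have "x' \<in> mball x r" using near x'M x by (simp add: d_def)
      ultimately show ?thesis by blast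
    qed
    thus ?thesis unfolding metric_closure_of by blast
  qed
  \<comment> \<open>Adding \<open>M\<close> keeps the intersection inside \<open>M\<close> even if
    \<open>V\<close> is empty.\<close>
  define \<G> where "\<G> = (\<lambda>(v, n). G v n) ` (V \<times> UNIV) \<union> {M}"
  have "mtopology closure_of \<Inter>\<G> = M"
  proof (rule metric_Baire_category[OF \<open>mcomplete\<close>])
    show "countable \<G>" unfolding \<G>_def using V by (intro countable_Un countable_image countable_SIGMA) auto
    fix T assume "T \<in> \<G>"
    thus "openin mtopology T \<and> mtopology closure_of T = M"
      using opn dense closure_of_topspace[of mtopology] openin_topspace[of mtopology]
      by (auto simp: \<G>_def)
  qed
  moreover have "xg + 0 \<in> M" by (rule shifted) (auto simp: gen_kernel_def l2_zero intro: exI[of _ 0])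
  ultimately obtain x where x: "x \<in> \<Inter>\<G>" by (metis all_not_in_conv closure_of_empty)
  hence xM: "x \<in> M" and xG: "\<And>v n. v \<in> V \<Longrightarrow> x \<in> G v n" by (auto simp: \<G>_def)
  show ?thesis
  proof (rule cyclic_opI[OF M_l2[OF xM]])
    fix v assume v: "v \<in> V"
    have "\<exists>p. l2_norm V (delta v - papp p x) < \<epsilon>" if e: "\<epsilon> > 0" for \<epsilon>
    proof -
      obtain n where n: "1 / real (Suc n) < \<epsilon>" using reals_Archimedean[OF e] unfolding inverse_eq_divide by blast
      obtain p where "l2_norm V (delta v - papp p x) < 1 / real (Suc n)"
        using xG[OF v, of n] unfolding G_def by blast
      thus ?thesis using n by (intro exI[of _ p]) linarith
    qed
    thus "delta v \<in> orbit_closure x" using v by (simp add: orbit_closure_def delta_l2)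
  qed
qed

end

subsection \<open>Polynomial approximation on the circle with a flat weight\<close>

text \<open>The exponential makes the logarithm of \<open>flat\<close> non-integrable on the circle,
  the situation in which Szego's theorem predicts that polynomial multiples are dense. The factor
  \<open>cmod (1 - z)\<close> forces the value 0 at \<open>z = 1\<close>, where the quotient in the
  exponent is a division by zero.\<close>

definition flat :: "complex \<Rightarrow> complex" where
  "flat z = of_real (cmod (1 - z) * exp (- 1 / (cmod (1 - z))\<^sup>2))"

text \<open>The closure is taken in the uniform norm on the circle rather than in the mean square
  norm; uniform bounds pass to \<open>l2 V\<close> through Bessel's inequality.\<close>

definition flat_span :: "(complex \<Rightarrow> complex) set" where
  "flat_span = {f. \<forall>\<epsilon>>0. \<exists>p. \<forall>z\<in>sphere 0 1. cmod (f z - poly p z * flat z) < \<epsilon>}"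

lemma norm_flat: "cmod (flat z) = cmod (1 - z) * exp (- 1 / (cmod (1 - z))\<^sup>2)"
  by (simp add: flat_def norm_mult)

lemma norm_flat_le:
  assumes "z \<in> sphere 0 1"
  shows "cmod (flat z) \<le> 2"
proof -
  have "cmod (flat z) \<le> cmod (1 - z) * 1"
    unfolding norm_flat by (intro mult_left_mono) auto
  also have "\<dots> \<le> 2" using norm_triangle_ineq4[of 1 z] assms by simp
  finally show ?thesis .
qed

text \<open>Only the point 1 needs an argument, and there \<open>cmod (1 - z)\<close> is a
  majorant.\<close>

lemma continuous_on_flat: "continuous_on S flat"
proof -
  have "isCont flat z" for z
  proof (cases "z = 1")
    case True
    have "(flat \<longlongrightarrow> 0) (at 1)"
    proof (rule Lim_null_comparison)
      show "\<forall>\<^sub>F z in at 1. cmod (flat z) \<le> cmod (1 - z)"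
        unfolding norm_flat by (intro always_eventually allI mult_left_le) auto
      show "((\<lambda>z. cmod (1 - z)) \<longlongrightarrow> 0) (at (1::complex))"
        by (rule tendsto_eq_intros refl | simp)+
    qed
    thus ?thesis using True by (simp add: isCont_def flat_def)
  next
    case False
    thus ?thesis unfolding flat_def
      by (intro continuous_intros) auto
  qed
  thus ?thesis by (simp add: continuous_at_imp_continuous_on)
qed

text \<open>Taylor polynomials converge uniformly on the closed unit disc. They keep the value at
  the origin exactly, which \<open>flat_div_z\<close> needs in order to divide by
  \<open>z\<close>.\<close>

lemma holomorphic_polynomial_approx:
  assumes f: "f holomorphic_on ball 0 R" and R: "R > 1" and "\<epsilon> > 0"
  shows "\<exists>p. poly p 0 = f 0 \<and> (\<forall>z\<in>sphere 0 1. cmod (f z - poly p z) < \<epsilon>)"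
proof -
  define a where "a n = (deriv ^^ n) f 0 / fact n" for n
  have sums: "(\<lambda>n. a n * z ^ n) sums f z" if "z \<in> ball 0 R" for z
    using holomorphic_power_series[OF f that] by (simp add: a_def)
  \<comment> \<open>Convergence at a point of modulus strictly between 1 and \<open>R\<close> puts
    the radius of convergence above 1.\<close>
  define z0 where "z0 = complex_of_real ((1 + R) / 2)"
  have n0: "norm z0 = (1 + R) / 2" using R unfolding z0_def norm_of_real by simp
  have "summable (\<lambda>n. a n * z0 ^ n)"
    using sums[of z0] R n0 by (auto intro: sums_summable)
  hence "ereal (norm z0) \<le> conv_radius a" by (rule conv_radius_geI)
  moreover have "ereal 1 < ereal (norm z0)" using R unfolding n0 by simp
  ultimately have "ereal 1 < conv_radius a" by (rule less_le_trans[rotated])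
  hence "uniform_limit (cball 0 1) (\<lambda>n x. \<Sum>i<n. a i * (x - 0) ^ i) (\<lambda>x. \<Sum>i. a i * (x - 0) ^ i) sequentially"
    by (intro powser_uniform_limit) simp
  from uniform_limitD[OF this \<open>\<epsilon> > 0\<close>] obtain n where
    n: "\<And>m x. m \<ge> n \<Longrightarrow> x \<in> cball 0 1 \<Longrightarrow> dist (\<Sum>i<m. a i * x ^ i) (\<Sum>i. a i * x ^ i) < \<epsilon>"
    unfolding eventually_sequentially diff_zero by blast
  \<comment> \<open>\<open>Suc n\<close> terms, so that the constant term is present even for
    \<open>n = 0\<close>.\<close>
  define p where "p = (\<Sum>i<Suc n. monom (a i) i)"
  have p: "poly p z = (\<Sum>i<Suc n. a i * z ^ i)" for z
    by (simp add: p_def poly_sum poly_monom del: sum.lessThan_Suc)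
  have "poly p 0 = a 0"
    unfolding p by (subst sum.lessThan_Suc_shift) (simp del: sum.lessThan_Suc)
  hence "poly p 0 = f 0" by (simp add: a_def)
  moreover have "cmod (f z - poly p z) < \<epsilon>" if "z \<in> sphere 0 1" for z
  proof -
    have "f z = (\<Sum>i. a i * z ^ i)" using sums[of z] that R by (intro sums_unique) auto
    thus ?thesis using n[of "Suc n" z] that by (simp add: p dist_norm norm_minus_commute del: sum.lessThan_Suc)
  qed
  ultimately show ?thesis by blast
qed

text \<open>The Poisson kernel decays away from \<open>1\<close>, and near \<open>1\<close> it grows more slowly than \<open>1 / \<bar>1 - z\<bar>\<^sup>2\<close>;
  so these functions with value \<open>1\<close> at the origin are small on the circle in the weight \<open>flat\<close>.\<close>

lemma flat_peak_bound:
  fixes c d r :: real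
  assumes c: "c \<ge> 1" and d: "d = 1 / (4 * c)" and r: "0 < r" "r < 1" "r\<^sup>2 = 1 - d\<^sup>2 / 8"
    and z: "z \<in> sphere 0 1"
  shows "cmod (exp (of_real c * (1 / (1 - of_real r * z) - 1))) * cmod (flat z) \<le> 2 * exp (- c / 4)"
proof -
  define s where "s = cmod (1 - z)"
  define w where "w = 1 - of_real r * z"
  have s0: "0 \<le> s" by (simp add: s_def)
  have s2: "s \<le> 2" using norm_triangle_ineq4[of 1 z] z by (simp add: s_def)
  \<comment> \<open>Here \<open>1 - z\<close> differs from \<open>w\<close> by a vector of length
    \<open>1 - r\<close>, and \<open>1 - r\<close> is itself at most \<open>cmod w\<close>.\<close>
  have sw: "s \<le> 2 * cmod w"
  proof -
    have "1 - z = w - of_real (1 - r) * z" by (simp add: w_def algebra_simps)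
    hence "s \<le> cmod w + cmod (of_real (1 - r) * z)" unfolding s_def by (metis norm_triangle_ineq4)
    also have "cmod (of_real (1 - r) * z) = 1 - r" using z r by (simp only: norm_mult norm_of_real) simp
    also have "1 - r \<le> cmod w"
      using norm_triangle_ineq2[of 1 "of_real r * z"] z r by (simp add: w_def norm_mult)
    finally show ?thesis by simp
  qed
  have "d > 0" using c d by simp
  have Re: "cmod (exp (of_real c * (1 / w - 1))) = exp (c * (Re (1 / w) - 1))"
    by simp
  \<comment> \<open>At \<open>s = 0\<close> the weight vanishes. For \<open>s < d\<close> the factor
    \<open>exp (- 1 / s^2)\<close> absorbs the growth \<open>exp (2 c / s)\<close>. For
    \<open>s \<ge> d\<close> the exponent is already at most \<open>- c / 4\<close>, because
    \<open>r\<close> is close enough to 1.\<close>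
  consider "s = 0" | "0 < s" "s < d" | "s \<ge> d" using s0 by linarith
  hence "exp (c * (Re (1 / w) - 1)) * (s * exp (- 1 / s\<^sup>2)) \<le> 2 * exp (- c / 4)"
  proof cases
    case 2
    have "Re (1 / w) \<le> cmod (1 / w)" by (rule complex_Re_le_cmod)
    also have "\<dots> \<le> 2 / s" using sw 2 by (simp add: norm_divide divide_simps)
    finally have "c * (Re (1 / w) - 1) \<le> c * (2 / s)" using c by (intro mult_left_mono) auto
    also have "c * (2 / s) \<le> (1 / 2) / s\<^sup>2"
    proof -
      have "4 * c * s \<le> 1" using 2 c unfolding d by (simp add: field_simps)
      thus ?thesis using 2 by (simp add: field_simps power2_eq_square)
    qed
    finally have 1: "c * (Re (1 / w) - 1) + (- 1 / s\<^sup>2) \<le> - ((1 / 2) / s\<^sup>2)" by (simp add: field_simps)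
    have "c / 4 \<le> (1/2) / s\<^sup>2"
    proof -
      have "s * c \<le> 1/4" using 2 c unfolding d by (simp add: field_simps)
      hence "s * (s * c) \<le> 2 * (1/4)" using s2 s0 c by (intro mult_mono) auto
      thus ?thesis using 2 by (simp add: field_simps power2_eq_square)
    qed
    with 1 have "exp (c * (Re (1 / w) - 1) + (- 1 / s\<^sup>2)) \<le> exp (- c / 4)" by simp
    hence "s * exp (c * (Re (1 / w) - 1) + (- 1 / s\<^sup>2)) \<le> 2 * exp (- c / 4)"
      using s2 s0 by (intro mult_mono) auto
    thus ?thesis unfolding exp_add by (simp add: mult_ac)
  next
    case 3
    hence wd: "d / 2 \<le> cmod w" using sw by simp
    hence w0: "cmod w > 0" using \<open>d > 0\<close> by linarith
    have n: "(cmod w)\<^sup>2 = 1 - 2 * r * Re z + r\<^sup>2"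
    proof -
      have "(Re z)\<^sup>2 + (Im z)\<^sup>2 = 1" using z by (simp add: cmod_def)
      hence "r\<^sup>2 * ((Re z)\<^sup>2 + (Im z)\<^sup>2) = r\<^sup>2" by simp
      thus ?thesis unfolding cmod_power2 w_def by (simp add: power2_eq_square algebra_simps)
    qed
    have "Re (1 / w) = Re w / (cmod w)\<^sup>2" by (simp add: Re_divide cmod_power2)
    \<comment> \<open>On the circle \<open>Re (1 / w)\<close> is half of 1 plus the Poisson kernel
      \<open>(1 - r^2) / (cmod w)^2\<close>; with \<open>1 - r^2 = d^2 / 8\<close> and
      \<open>cmod w \<ge> d / 2\<close> the second half is at most \<open>1/4\<close>.\<close>
    also have "Re w = ((cmod w)\<^sup>2 + (1 - r\<^sup>2)) / 2" unfolding n by (simp add: w_def)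
    also have "\<dots> / (cmod w)\<^sup>2 = 1 / 2 + (d\<^sup>2 / 16) / (cmod w)\<^sup>2"
      unfolding r(3) using w0 by (simp add: add_divide_distrib)
    also have "\<dots> \<le> 1 / 2 + 1 / 4"
    proof -
      have "(d / 2)\<^sup>2 \<le> (cmod w)\<^sup>2" using wd \<open>d > 0\<close> by (intro power_mono) auto
      thus ?thesis using w0 by (simp add: field_simps)
    qed
    finally have "c * (Re (1 / w) - 1) \<le> c * (- 1 / 4)" using c by (intro mult_left_mono) auto
    hence 1: "exp (c * (Re (1 / w) - 1)) \<le> exp (- c / 4)" by simp
    have "s * exp (- 1 / s\<^sup>2) \<le> 2 * 1" using s2 s0 by (intro mult_mono) auto
    with 1 have "exp (c * (Re (1 / w) - 1)) * (s * exp (- 1 / s\<^sup>2)) \<le> exp (- c / 4) * 2"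
      using s0 by (intro mult_mono) auto
    thus ?thesis by simp
  qed auto
  thus ?thesis unfolding norm_flat Re[unfolded w_def] s_def w_def .
qed

text \<open>Take a polynomial \<open>p0\<close> with \<open>p0(0) = 1\<close> that is small on the
  circle in the weight \<open>flat\<close>, and write \<open>1 - p0 = z p\<close>. Then
  \<open>flat / z - p flat = flat p0 / z\<close>, which is small. This is how negative powers of
  \<open>z\<close> become reachable.\<close>

lemma flat_div_z: "(\<lambda>z. flat z / z) \<in> flat_span"
  unfolding flat_span_def
proof (safe)
  fix \<epsilon> :: real assume e: "\<epsilon> > 0"
  \<comment> \<open>Large enough that \<open>exp (- c / 4) < \<epsilon> / 4\<close>, by
    \<open>exp x \<ge> 1 + x\<close>.\<close>
  define c where "c = 1 + 16 / \<epsilon>"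
  define d where "d = 1 / (4 * c)"
  define r where "r = sqrt (1 - d\<^sup>2 / 8)"
  have c: "c \<ge> 1" using e by (simp add: c_def)
  hence d01: "0 < d" "d \<le> 1" by (auto simp: d_def)
  hence "d\<^sup>2 \<le> 1" "d\<^sup>2 > 0" by (auto simp: power_le_one)
  hence r: "0 < r" "r < 1" "r\<^sup>2 = 1 - d\<^sup>2 / 8" by (auto simp: r_def)
  \<comment> \<open>The singularity at \<open>1 / r\<close> lies outside the closed disc, and
    \<open>q 0 = 1\<close>.\<close>
  define q where "q z = exp (of_real c * (1 / (1 - of_real r * z) - 1))" for z :: complex
  have "1 - complex_of_real r * z \<noteq> 0" if "z \<in> ball 0 (1 / r)" for z
  proof
    assume "1 - complex_of_real r * z = 0"
    hence "cmod (complex_of_real r * z) = 1" by (metis eq_iff_diff_eq_0 norm_one)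
    thus False using that r by (simp add: norm_mult field_simps)
  qed
  hence "q holomorphic_on ball 0 (1 / r)" unfolding q_def by (intro holomorphic_intros) auto
  then obtain p0 where p0: "poly p0 0 = q 0" "\<And>z. z \<in> sphere 0 1 \<Longrightarrow> cmod (q z - poly p0 z) < \<epsilon> / 4"
    using holomorphic_polynomial_approx[of q "1 / r" "\<epsilon> / 4"] r e by auto
  obtain a p where ap: "1 - p0 = pCons a p" by (cases "1 - p0")
  have "poly (1 - p0) 0 = 0" using p0 by (simp add: q_def)
  hence "a = 0" unfolding ap by simp
  have p: "1 - poly p0 z = z * poly p z" for z
    using arg_cong[OF ap, of "\<lambda>p. poly p z"] \<open>a = 0\<close> by simp
  show "\<exists>p. \<forall>z\<in>sphere 0 1. cmod (flat z / z - poly p z * flat z) < \<epsilon>"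
  proof (intro exI ballI)
    fix z :: complex assume z: "z \<in> sphere 0 1"
    hence z0: "z \<noteq> 0" "cmod z = 1" by auto
    have "flat z / z - poly p z * flat z = flat z / z * (1 - z * poly p z)"
      using z0 by (simp add: field_simps)
    also have "\<dots> = flat z / z * poly p0 z" unfolding p[symmetric] by simp
    finally have "cmod (flat z / z - poly p z * flat z) = cmod (flat z) * cmod (poly p0 z)"
      using z0 by (simp add: norm_mult norm_divide)
    also have "\<dots> \<le> cmod (flat z) * (cmod (q z) + \<epsilon> / 4)"
      using p0(2)[OF z] norm_triangle_ineq3[of "q z" "poly p0 z"] by (intro mult_left_mono) auto
    also have "\<dots> = cmod (q z) * cmod (flat z) + cmod (flat z) * (\<epsilon> / 4)" by (simp add: algebra_simps)
    also have "\<dots> \<le> 2 * exp (- c / 4) + 2 * (\<epsilon> / 4)"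
      unfolding q_def using norm_flat_le[OF z] e
      by (intro add_mono flat_peak_bound[OF c d_def r z] mult_right_mono) auto
    also have "\<dots> < \<epsilon>"
    proof -
      have "exp (- c / 4) = 1 / exp (c / 4)" by (simp add: exp_minus field_simps)
      also have "\<dots> \<le> 1 / (1 + c / 4)" using c by (intro divide_left_mono exp_ge_add_one_self) auto
      also have "\<dots> < \<epsilon> / 4"
      proof -
        have "16 < \<epsilon> * c" using e by (simp add: c_def algebra_simps)
        thus ?thesis using c e by (simp add: field_simps)
      qed
      finally show ?thesis by simp
    qed
    finally show "cmod (flat z / z - poly p z * flat z) < \<epsilon>" .
  qed
qed

section \<open>Closure properties of \<open>flat_span\<close>\<close>

lemma flat_spanD:
  assumes "f \<in> flat_span" "\<epsilon> > 0"
  obtains p where "\<And>z. z \<in> sphere 0 1 \<Longrightarrow> cmod (f z - poly p z * flat z) < \<epsilon>"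
  using assms unfolding flat_span_def by blast

lemma flat_span_closed:
  assumes "\<And>\<epsilon>. \<epsilon> > 0 \<Longrightarrow> \<exists>g\<in>flat_span. \<forall>z\<in>sphere 0 1. cmod (f z - g z) < \<epsilon>"
  shows "f \<in> flat_span"
  unfolding flat_span_def
proof safe
  fix \<epsilon> :: real assume e: "\<epsilon> > 0"
  obtain g where g: "g \<in> flat_span" "\<And>z. z \<in> sphere 0 1 \<Longrightarrow> cmod (f z - g z) < \<epsilon>/2"
    using assms[OF half_gt_zero[OF e]] by blast
  obtain p where p: "\<And>z. z \<in> sphere 0 1 \<Longrightarrow> cmod (g z - poly p z * flat z) < \<epsilon>/2"
    using flat_spanD[OF g(1) half_gt_zero[OF e]] by blast
  show "\<exists>p. \<forall>z\<in>sphere 0 1. cmod (f z - poly p z * flat z) < \<epsilon>"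
    using norm_diff_triangle_less[OF g(2) p] by (intro exI[of _ p] ballI) fastforce
qed

lemma flat_span_cong:
  assumes "g \<in> flat_span" "\<And>z. z \<in> sphere 0 1 \<Longrightarrow> f z = g z"
  shows "f \<in> flat_span"
  by (rule flat_span_closed) (use assms in \<open>auto intro!: bexI[of _ g]\<close>)

lemma flat_span_add:
  assumes "f \<in> flat_span" "g \<in> flat_span"
  shows "(\<lambda>z. f z + g z) \<in> flat_span"
  unfolding flat_span_def
proof safe
  fix \<epsilon> :: real assume e: "\<epsilon> > 0"
  obtain p where p: "\<And>z. z \<in> sphere 0 1 \<Longrightarrow> cmod (f z - poly p z * flat z) < \<epsilon>/2"
    using flat_spanD[OF assms(1) half_gt_zero[OF e]] by blast
  obtain q where q: "\<And>z. z \<in> sphere 0 1 \<Longrightarrow> cmod (g z - poly q z * flat z) < \<epsilon>/2"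
    using flat_spanD[OF assms(2) half_gt_zero[OF e]] by blast
  show "\<exists>p. \<forall>z\<in>sphere 0 1. cmod (f z + g z - poly p z * flat z) < \<epsilon>"
  proof (intro exI[of _ "p + q"] ballI)
    fix z :: complex assume z: "z \<in> sphere 0 1"
    have eq: "f z + g z - poly (p + q) z * flat z = (f z - poly p z * flat z) + (g z - poly q z * flat z)"
      by (simp add: algebra_simps)
    show "cmod (f z + g z - poly (p + q) z * flat z) < \<epsilon>"
      using norm_triangle_ineq[of "f z - poly p z * flat z" "g z - poly q z * flat z"] p[OF z] q[OF z]
      unfolding eq by linarith
  qed
qed

lemma flat_span_cmult:
  assumes "f \<in> flat_span"
  shows "(\<lambda>z. c * f z) \<in> flat_span"
  unfolding flat_span_def
proof safe
  fix \<epsilon> :: real assume e: "\<epsilon> > 0"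
  have c: "cmod c + 1 > 0" by (simp add: add_nonneg_pos)
  obtain p where p: "\<And>z. z \<in> sphere 0 1 \<Longrightarrow> cmod (f z - poly p z * flat z) < \<epsilon> / (cmod c + 1)"
    using flat_spanD[OF assms divide_pos_pos[OF e c]] by blast
  show "\<exists>p. \<forall>z\<in>sphere 0 1. cmod (c * f z - poly p z * flat z) < \<epsilon>"
  proof (intro exI[of _ "smult c p"] ballI)
    fix z :: complex assume z: "z \<in> sphere 0 1"
    have "c * f z - poly (smult c p) z * flat z = c * (f z - poly p z * flat z)"
      by (simp add: algebra_simps)
    hence "cmod (c * f z - poly (smult c p) z * flat z) = cmod c * cmod (f z - poly p z * flat z)"
      by (simp add: norm_mult)
    also have "\<dots> \<le> (cmod c + 1) * cmod (f z - poly p z * flat z)"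
      by (intro mult_right_mono) auto
    also have "\<dots> < \<epsilon>" using p[OF z] c by (simp add: pos_less_divide_eq mult.commute)
    finally show "cmod (c * f z - poly (smult c p) z * flat z) < \<epsilon>" .
  qed
qed

lemma flat_span_flat: "flat \<in> flat_span"
  unfolding flat_span_def by (auto intro: exI[of _ 1])

lemma flat_span_mult_z:
  assumes "f \<in> flat_span"
  shows "(\<lambda>z. z * f z) \<in> flat_span"
  unfolding flat_span_def
proof safe
  fix \<epsilon> :: real assume e: "\<epsilon> > 0"
  obtain p where p: "\<And>z. z \<in> sphere 0 1 \<Longrightarrow> cmod (f z - poly p z * flat z) < \<epsilon>"
    using flat_spanD[OF assms e] by blast
  show "\<exists>p. \<forall>z\<in>sphere 0 1. cmod (z * f z - poly p z * flat z) < \<epsilon>"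
  proof (intro exI[of _ "pCons 0 p"] ballI)
    fix z :: complex assume z: "z \<in> sphere 0 1"
    have "z * f z - poly (pCons 0 p) z * flat z = z * (f z - poly p z * flat z)"
      by (simp add: algebra_simps)
    thus "cmod (z * f z - poly (pCons 0 p) z * flat z) < \<epsilon>"
      using p[OF z] z by (simp add: norm_mult)
  qed
qed

text \<open>Only the constant term of a polynomial obstructs division by \<open>z\<close>, and
  \<open>flat_div_z\<close> deals with it.\<close>

lemma flat_span_div_z:
  assumes "f \<in> flat_span"
  shows "(\<lambda>z. f z / z) \<in> flat_span"
proof (rule flat_span_closed)
  fix \<epsilon> :: real assume e: "\<epsilon> > 0"
  obtain p where p: "\<And>z. z \<in> sphere 0 1 \<Longrightarrow> cmod (f z - poly p z * flat z) < \<epsilon>"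
    using flat_spanD[OF assms e] by blast
  obtain a q where pq: "p = pCons a q" by (cases p)
  have q: "(\<lambda>z. poly q z * flat z) \<in> flat_span"
    unfolding flat_span_def by (auto intro: exI[of _ q])
  show "\<exists>g\<in>flat_span. \<forall>z\<in>sphere 0 1. cmod (f z / z - g z) < \<epsilon>"
  proof (intro bexI ballI)
    show "(\<lambda>z. a * (flat z / z) + poly q z * flat z) \<in> flat_span"
      by (intro flat_span_add flat_span_cmult flat_div_z q)
    fix z :: complex assume z: "z \<in> sphere 0 1"
    hence "z \<noteq> 0" by auto
    hence "f z / z - (a * (flat z / z) + poly q z * flat z) = (f z - poly p z * flat z) / z"
      by (simp add: pq field_simps)
    thus "cmod (f z / z - (a * (flat z / z) + poly q z * flat z)) < \<epsilon>"
      using p[OF z] z by (simp add: norm_divide)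
  qed
qed

text \<open>On the circle \<open>cnj z = 1 / z\<close>, so a real linear form is a combination of
  \<open>z\<close> and \<open>1 / z\<close>, both of which preserve \<open>flat_span\<close>. The
  induction varies \<open>f\<close> because the product case applies one factor after the
  other.\<close>

lemma flat_span_real_polynomial:
  assumes "real_polynomial_function g" "f \<in> flat_span"
  shows "(\<lambda>z. of_real (g z) * f z) \<in> flat_span"
  using assms
proof (induction arbitrary: f rule: real_polynomial_function.induct)
  case (linear g)
  interpret bounded_linear g by fact
  have g: "g z = Re z * g 1 + Im z * g \<i>" for z
  proof -
    have "z = Re z *\<^sub>R 1 + Im z *\<^sub>R \<i>" by (simp add: complex_eq_iff)
    hence "g z = g (Re z *\<^sub>R 1 + Im z *\<^sub>R \<i>)" by simp
    thus ?thesis by (simp only: add scaleR real_scaleR_def)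
  qed
  define \<alpha> where "\<alpha> = (complex_of_real (g 1) - \<i> * of_real (g \<i>)) / 2"
  define \<beta> where "\<beta> = (complex_of_real (g 1) + \<i> * of_real (g \<i>)) / 2"
  show ?case
  proof (rule flat_span_cong)
    show "(\<lambda>z. \<alpha> * (z * f z) + \<beta> * (f z / z)) \<in> flat_span"
      by (intro flat_span_add flat_span_cmult flat_span_mult_z flat_span_div_z \<open>f \<in> flat_span\<close>)
    fix z :: complex assume z: "z \<in> sphere 0 1"
    hence "z \<noteq> 0" "z * cnj z = 1" by (auto simp: complex_norm_square[symmetric])
    hence "1 / z = cnj z" by (simp add: field_simps)
    hence "\<alpha> * (z * f z) + \<beta> * (f z / z) = (\<alpha> * z + \<beta> * cnj z) * f z"
      by (simp add: algebra_simps divide_inverse)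
    also have "\<alpha> * z + \<beta> * cnj z = of_real (g z)"
      unfolding g[of z] \<alpha>_def \<beta>_def by (simp add: complex_eq_iff field_simps)
    finally show "of_real (g z) * f z = \<alpha> * (z * f z) + \<beta> * (f z / z)" by simp
  qed
next
  case (const c)
  thus ?case by (intro flat_span_cmult)
next
  case (add g h)
  from flat_span_add[OF add.IH(1)[OF add.prems] add.IH(2)[OF add.prems]]
  show ?case by (simp add: algebra_simps)
next
  case (mult g h)
  from mult.IH(1)[OF mult.IH(2)[OF mult.prems]] show ?case by (simp add: mult_ac)
qed

text \<open>Stone-Weierstrass reduces \<open>g\<close> to a polynomial in the real and imaginary
  parts of \<open>z\<close>.\<close>

lemma flat_span_continuous:
  assumes g: "continuous_on (sphere 0 1) g"
  shows "(\<lambda>z. g z * flat z) \<in> flat_span"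
proof (rule flat_span_closed)
  fix \<epsilon> :: real assume e: "\<epsilon> > 0"
  obtain h where h: "polynomial_function h" "\<And>z. z \<in> sphere 0 1 \<Longrightarrow> cmod (g z - h z) < \<epsilon> / 4"
    using Stone_Weierstrass_polynomial_function[OF _ g, of "\<epsilon> / 4"] e by auto
  have rp: "real_polynomial_function (\<lambda>z. Re (h z))" "real_polynomial_function (\<lambda>z. Im (h z))"
    using h(1) bounded_linear_Re bounded_linear_Im unfolding polynomial_function_def o_def by blast+
  show "\<exists>f\<in>flat_span. \<forall>z\<in>sphere 0 1. cmod (g z * flat z - f z) < \<epsilon>"
  proof (intro bexI ballI)
    show "(\<lambda>z. of_real (Re (h z)) * flat z + \<i> * (of_real (Im (h z)) * flat z)) \<in> flat_span"
      by (intro flat_span_add flat_span_cmult flat_span_real_polynomial rp flat_span_flat)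
    fix z :: complex assume z: "z \<in> sphere 0 1"
    have "of_real (Re (h z)) * flat z + \<i> * (of_real (Im (h z)) * flat z) = h z * flat z"
      by (subst (3) complex_eq) (simp add: algebra_simps)
    hence "cmod (g z * flat z - (of_real (Re (h z)) * flat z + \<i> * (of_real (Im (h z)) * flat z)))
      = cmod (g z - h z) * cmod (flat z)"
      by (simp add: algebra_simps flip: norm_mult)
    also have "\<dots> \<le> \<epsilon> / 4 * 2"
      using h(2)[OF z] norm_flat_le[OF z] e by (intro mult_mono) auto
    also have "\<dots> < \<epsilon>" using e by simp
    finally show "cmod (g z * flat z - (of_real (Re (h z)) * flat z + \<i> * (of_real (Im (h z)) * flat z))) < \<epsilon>" .
  qed
qed

text \<open>The quotient \<open>f / flat\<close> need not be continuous at 1, so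
  \<open>f / (flat + \<delta>)\<close> replaces it. The error
  \<open>f \<delta> / (flat + \<delta>)\<close> is small near 1 because \<open>f\<close> is, and
  elsewhere because \<open>flat\<close> is bounded below.\<close>

lemma flat_span_vanishing:
  assumes f: "continuous_on (sphere 0 1) f" and "f 1 = 0"
  shows "f \<in> flat_span"
proof (rule flat_span_closed)
  fix \<epsilon> :: real assume e: "\<epsilon> > 0"
  define K where "K = {z \<in> sphere 0 1. \<epsilon> / 2 \<le> cmod (f z)}"
  have ne: "sphere (0::complex) 1 \<noteq> {}" by (auto intro: exI[of _ 1])
  \<comment> \<open>On \<open>K\<close> the second summand is 0, so a positive minimum of
    \<open>h\<close> over the circle bounds \<open>flat\<close> below on \<open>K\<close>, which may
    be empty.\<close>
  define h where "h z = cmod (flat z) + max 0 (\<epsilon> / 2 - cmod (f z))" for z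
  have "continuous_on (sphere 0 1) h"
    unfolding h_def by (intro continuous_intros f continuous_on_flat)
  then obtain z0 where z0: "z0 \<in> sphere 0 1" "\<And>z. z \<in> sphere 0 1 \<Longrightarrow> h z0 \<le> h z"
    using continuous_attains_inf[OF compact_sphere ne, of h] by blast
  have "h z0 > 0"
  proof (cases "z0 = 1")
    case True
    thus ?thesis using e \<open>f 1 = 0\<close> by (simp add: h_def add_nonneg_pos)
  next
    case False
    hence "cmod (flat z0) > 0" by (simp add: flat_def)
    thus ?thesis by (simp add: h_def add_pos_nonneg)
  qed
  then obtain m where m: "m > 0" "\<And>z. z \<in> K \<Longrightarrow> m \<le> cmod (flat z)"
    using z0(2) unfolding K_def h_def by fastforce
  have "bounded (f ` sphere 0 1)"
    by (intro compact_imp_bounded compact_continuous_image f compact_sphere)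
  then obtain B where B: "B > 0" "\<And>z. z \<in> sphere 0 1 \<Longrightarrow> cmod (f z) \<le> B"
    unfolding bounded_pos by blast
  \<comment> \<open>Chosen so that \<open>B * \<delta> / m = \<epsilon> / 2\<close> bounds the error
    on \<open>K\<close>.\<close>
  define \<delta> where "\<delta> = m * \<epsilon> / (2 * B)"
  have d: "\<delta> > 0" using m B e by (simp add: \<delta>_def)
  define w where "w z = cmod (flat z) + \<delta>" for z
  have w: "w z > 0" for z using d by (simp add: w_def add_nonneg_pos)
  have fl: "of_real (cmod (flat z)) = flat z" for z by (simp add: flat_def norm_mult)
  show "\<exists>g\<in>flat_span. \<forall>z\<in>sphere 0 1. cmod (f z - g z) < \<epsilon>"
  proof (intro bexI ballI)
    have "continuous_on (sphere 0 1) (\<lambda>z. f z / of_real (w z))"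
      unfolding w_def using w[unfolded w_def]
      by (intro continuous_intros f continuous_on_flat) (metis less_irrefl of_real_eq_0_iff)
    thus "(\<lambda>z. f z / of_real (w z) * flat z) \<in> flat_span" by (rule flat_span_continuous)
    fix z :: complex assume z: "z \<in> sphere 0 1"
    have fw: "flat z = of_real (w z) - of_real \<delta>" by (simp add: w_def fl)
    have "f z - f z / of_real (w z) * flat z = f z * of_real \<delta> / of_real (w z)"
      unfolding fw using w[of z] by (simp add: field_simps)
    hence eq: "cmod (f z - f z / of_real (w z) * flat z) = cmod (f z) * \<delta> / w z"
      using w[of z] d by (simp add: norm_mult norm_divide)
    also have "\<dots> < \<epsilon>"
    proof (cases "z \<in> K")
      case True
      have "cmod (f z) * \<delta> / w z \<le> B * \<delta> / m"
        using m d B(1) B(2)[OF z] m(2)[OF True] by (intro frac_le mult_mono) (auto simp: w_def)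
      also have "\<dots> = \<epsilon> / 2" using m B by (simp add: \<delta>_def)
      also have "\<dots> < \<epsilon>" using e by simp
      finally show ?thesis .
    next
      case False
      have "cmod (f z) * \<delta> / w z \<le> cmod (f z) * 1"
        using w[of z] d by (simp only: times_divide_eq_right[symmetric], intro mult_left_mono) (auto simp: w_def)
      also have "\<dots> < \<epsilon>" using False z e by (simp add: K_def)
      finally show ?thesis .
    qed
    finally show "cmod (f z - f z / of_real (w z) * flat z) < \<epsilon>" .
  qed
qed

subsection \<open>Fourier coefficients\<close>

definition fourier :: "(complex \<Rightarrow> complex) \<Rightarrow> int \<Rightarrow> complex" where
  "fourier f n = integral {0..2*pi} (\<lambda>t. f (cis t) * cis (- (of_int n * t))) / (2 * pi)"

lemma integral_cis:
  "integral {0..2*pi} (\<lambda>t. cis (of_int n * t)) = (if n = 0 then 2 * pi else 0)"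
proof (cases "n = 0")
  case False
  have "((\<lambda>t. cis (of_int n * t)) has_integral
      (cis (of_int n * (2*pi)) / (\<i> * of_int n) - cis (of_int n * 0) / (\<i> * of_int n))) {0..2*pi}"
  proof (rule fundamental_theorem_of_calculus)
    fix t :: real
    have "((\<lambda>t. exp (\<i> * of_int n * of_real t) / (\<i> * of_int n)) has_vector_derivative
       (exp (\<i> * of_int n * of_real t))) (at t within {0..2*pi})"
      using False by (auto intro!: derivative_eq_intros has_vector_derivative_real_field)
    thus "((\<lambda>t. cis (of_int n * t) / (\<i> * of_int n)) has_vector_derivative cis (of_int n * t)) (at t within {0..2*pi})"
      by (simp add: cis_conv_exp mult_ac)
  qed simp
  moreover have "cis (of_int n * (2*pi)) = 1"
    by (metis cis_multiple_2pi Ints_of_int mult.commute)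
  ultimately show ?thesis using False by (auto dest: integral_unique)
qed (auto simp: scaleR_conv_of_real)

context
  fixes f :: "complex \<Rightarrow> complex"
  assumes f: "continuous_on (sphere 0 1) f"
begin

lemma continuous_on_circle: "continuous_on S (\<lambda>t. f (cis t))"
  by (rule continuous_on_compose2[OF f]) (auto intro!: continuous_intros)

lemma fourier_integrable: "(\<lambda>t. f (cis t) * cis (- (of_int n * t))) integrable_on {0..2*pi}"
  by (intro integrable_continuous_real continuous_intros continuous_on_circle)

lemma fourier_mult_z: "fourier (\<lambda>z. z * f z) n = fourier f (n - 1)"
proof -
  have "cis t * f (cis t) * cis (- (of_int n * t)) = f (cis t) * cis (- (of_int (n - 1) * t))" for t
  proof -
    have "cis t * cis (- (of_int n * t)) = cis (- (of_int (n - 1) * t))"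
      by (simp add: cis_mult algebra_simps)
    thus ?thesis by (metis mult.assoc mult.commute)
  qed
  thus ?thesis unfolding fourier_def by (simp only:)
qed

text \<open>With \<open>g\<close> the partial Fourier sum over \<open>F\<close>, both the inner
  product of \<open>h\<close> and \<open>g\<close> and the squared norm of \<open>g\<close> equal
  \<open>2 * pi * s\<close>. Integrating the square of \<open>cmod (h - g)\<close> therefore gives
  \<open>2 * pi * s\<close> at most the integral of the square of \<open>cmod h\<close>.\<close>

lemma bessel:
  assumes B: "\<And>z. z \<in> sphere 0 1 \<Longrightarrow> cmod (f z) \<le> B" and F: "finite F"
  shows "(\<Sum>n\<in>F. (cmod (fourier f n))\<^sup>2) \<le> B\<^sup>2"
proof -
  define c where "c = fourier f"
  define h where "h t = f (cis t)" for t
  define g where "g t = (\<Sum>n\<in>F. c n * cis (of_int n * t))" for t :: real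
  define s where "s = (\<Sum>n\<in>F. (cmod (c n))\<^sup>2)"
  have ch: "continuous_on {0..2*pi} h" unfolding h_def by (rule continuous_on_circle)
  have cg: "continuous_on {0..2*pi} g" unfolding g_def by (intro continuous_intros)
  note int = integrable_continuous_real
  have ih: "integral {0..2*pi} (\<lambda>t. h t * cis (- (of_int n * t))) = 2 * pi * c n" for n
    by (simp add: c_def fourier_def h_def)
  have cg': "cnj (g t) = (\<Sum>n\<in>F. cnj (c n) * cis (- (of_int n * t)))" for t
    by (simp add: g_def cis_cnj)
  have hg: "integral {0..2*pi} (\<lambda>t. h t * cnj (g t)) = 2 * pi * s"
  proof -
    have "integral {0..2*pi} (\<lambda>t. h t * cnj (g t)) =
        integral {0..2*pi} (\<lambda>t. \<Sum>n\<in>F. cnj (c n) * (h t * cis (- (of_int n * t))))"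
      by (simp add: cg' sum_distrib_left mult_ac)
    also have "\<dots> = (\<Sum>n\<in>F. integral {0..2*pi} (\<lambda>t. cnj (c n) * (h t * cis (- (of_int n * t)))))"
      by (intro integral_sum F int continuous_intros ch)
    also have "\<dots> = (\<Sum>n\<in>F. complex_of_real (2 * pi) * complex_of_real ((cmod (c n))\<^sup>2))"
      by (rule sum.cong[OF refl]) (simp only: integral_mult_right ih complex_norm_square, simp)
    finally show ?thesis by (simp add: s_def sum_distrib_left)
  qed
  have gg: "integral {0..2*pi} (\<lambda>t. g t * cnj (g t)) = 2 * pi * s"
  proof -
    have gc: "integral {0..2*pi} (\<lambda>t. g t * cis (- (of_int m * t))) = 2 * pi * c m" if "m \<in> F" for m
    proof -
      have "g t * cis (- (of_int m * t)) = (\<Sum>n\<in>F. c n * cis (of_int (n - m) * t))" for t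
        unfolding g_def sum_distrib_right
        by (intro sum.cong refl) (simp add: mult.assoc cis_mult left_diff_distrib)
      hence "integral {0..2*pi} (\<lambda>t. g t * cis (- (of_int m * t))) =
         integral {0..2*pi} (\<lambda>t. \<Sum>n\<in>F. c n * cis (of_int (n - m) * t))"
        by (simp only:)
      also have "\<dots> = (\<Sum>n\<in>F. integral {0..2*pi} (\<lambda>t. c n * cis (of_int (n - m) * t)))"
        by (intro integral_sum F int continuous_intros)
      also have "\<dots> = (\<Sum>n\<in>F. if n = m then 2 * pi * c m else 0)"
        by (intro sum.cong) (simp_all only: integral_mult_right integral_cis, auto)
      finally show ?thesis using that F by simp
    qed
    have "integral {0..2*pi} (\<lambda>t. g t * cnj (g t)) =
        integral {0..2*pi} (\<lambda>t. \<Sum>n\<in>F. cnj (c n) * (g t * cis (- (of_int n * t))))"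
      by (simp add: cg' sum_distrib_left mult_ac)
    also have "\<dots> = (\<Sum>n\<in>F. integral {0..2*pi} (\<lambda>t. cnj (c n) * (g t * cis (- (of_int n * t)))))"
      by (intro integral_sum F int continuous_intros cg)
    also have "\<dots> = (\<Sum>n\<in>F. complex_of_real (2 * pi) * complex_of_real ((cmod (c n))\<^sup>2))"
      by (rule sum.cong[OF refl]) (simp only: integral_mult_right gc complex_norm_square, simp)
    finally show ?thesis by (simp add: s_def sum_distrib_left)
  qed
  have re: "integral {0..2*pi} (\<lambda>t. Re (w t)) = Re (integral {0..2*pi} w)"
    if "continuous_on {0..2*pi} w" for w :: "real \<Rightarrow> complex"
    using integral_linear[OF int[OF that] bounded_linear_Re] by (simp add: o_def)
  have "0 \<le> integral {0..2*pi} (\<lambda>t. (cmod (h t - g t))\<^sup>2)"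
    by (intro integral_nonneg int continuous_intros ch cg) auto
  also have "\<dots> = integral {0..2*pi} (\<lambda>t. (cmod (h t))\<^sup>2 - 2 * Re (h t * cnj (g t)) + Re (g t * cnj (g t)))"
    by (intro integral_cong) (simp add: cmod_power2, simp add: power2_eq_square algebra_simps)
  also have "\<dots> = integral {0..2*pi} (\<lambda>t. (cmod (h t))\<^sup>2) - 2 * (2 * pi * s) + 2 * pi * s"
    by (subst integral_add integral_diff integral_mult_right re |
        (intro int continuous_intros ch cg; fail) | simp add: hg gg)+
  also have "integral {0..2*pi} (\<lambda>t. (cmod (h t))\<^sup>2) \<le> integral {0..2*pi} (\<lambda>t. B\<^sup>2)"
    by (intro integral_le int continuous_intros ch power_mono) (auto simp: h_def intro: B)
  finally have "2 * pi * s \<le> 2 * pi * B\<^sup>2" by (simp add: mult_ac)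
  hence "s \<le> B\<^sup>2" by simp
  thus ?thesis by (simp add: s_def c_def)
qed

end

lemma fourier_add:
  assumes "continuous_on (sphere 0 1) f" "continuous_on (sphere 0 1) g"
  shows "fourier (\<lambda>z. f z + g z) n = fourier f n + fourier g n"
  unfolding fourier_def
  by (simp add: distrib_right integral_add fourier_integrable assms add_divide_distrib)

lemma fourier_cmult: "fourier (\<lambda>z. c * f z) n = c * fourier f n"
  unfolding fourier_def by (simp add: mult.assoc)

lemma fourier_powi: "fourier (\<lambda>z. z powi k) n = (if n = k then 1 else 0)"
proof -
  have "cis t powi k * cis (- (of_int n * t)) = cis (of_int (k - n) * t)" for t
    by (simp add: cis_power_int cis_mult algebra_simps)
  thus ?thesis unfolding fourier_def by (simp only: integral_cis) simp
qed

subsection \<open>Backward shifts along a path\<close>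

text \<open>The numbers \<open>\<omega> k\<close> scale the unit vectors along the path; the uniform
  bound \<open>W\<close> makes square summable coefficients give vectors of
  \<open>l2 V\<close>.\<close>

locale path_operator = l2_operator +
  fixes ray :: "int \<Rightarrow> 'a" and \<omega> :: "int \<Rightarrow> real" and W :: real
  assumes inj_ray: "inj ray" and ray_V: "ray k \<in> V"
    and \<omega>_pos: "0 < \<omega> k" and \<omega>_le: "\<omega> k \<le> W"
begin

text \<open>The formal sum of \<open>b k\<close> times the scaled unit vectors, written by
  coordinates so that it makes sense for every \<open>b\<close>.\<close>

definition path_vec :: "(int \<Rightarrow> complex) \<Rightarrow> 'a \<Rightarrow> complex" where
  "path_vec b v = (if v \<in> range ray then of_real (\<omega> (inv ray v)) * b (inv ray v) else 0)"

lemma path_vec_ray [simp]: "path_vec b (ray k) = of_real (\<omega> k) * b k"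
  by (simp add: path_vec_def inv_f_f inj_ray)

lemma path_vec_off: "v \<notin> range ray \<Longrightarrow> path_vec b v = 0"
  by (simp add: path_vec_def)

lemma W_pos: "W > 0"
  using \<omega>_pos \<omega>_le order_less_le_trans by blast

lemma path_vec_l2:
  assumes D: "D \<ge> 0" and b: "\<And>F. finite F \<Longrightarrow> (\<Sum>k\<in>F. (cmod (b k))\<^sup>2) \<le> D\<^sup>2"
  shows "path_vec b \<in> l2 V \<and> l2_norm V (path_vec b) \<le> W * D"
proof (rule l2_boundI)
  show "0 \<le> W * D" using W_pos D by simp
  fix F assume F: "finite F" "F \<subseteq> V"
  define K where "K = ray -` F"
  have K: "finite K" unfolding K_def by (intro finite_vimageI F inj_ray)
  have "(\<Sum>v\<in>F. (cmod (path_vec b v))\<^sup>2) = (\<Sum>v\<in>ray ` K. (cmod (path_vec b v))\<^sup>2)"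
    using F by (intro sum.mono_neutral_right) (auto simp: K_def path_vec_off)
  also have "\<dots> = (\<Sum>k\<in>K. (cmod (path_vec b (ray k)))\<^sup>2)"
    by (subst sum.reindex) (auto intro: inj_on_subset[OF inj_ray])
  also have "\<dots> = (\<Sum>k\<in>K. (\<omega> k)\<^sup>2 * (cmod (b k))\<^sup>2)"
    by (simp add: norm_mult power_mult_distrib)
  also have "\<dots> \<le> (\<Sum>k\<in>K. W\<^sup>2 * (cmod (b k))\<^sup>2)"
    using \<omega>_le less_imp_le[OF \<omega>_pos] by (intro sum_mono mult_right_mono power_mono) auto
  also have "\<dots> \<le> W\<^sup>2 * D\<^sup>2"
    using b[OF K] by (simp add: sum_distrib_left[symmetric] mult_left_mono)
  finally show "L2_set (\<lambda>v. cmod (path_vec b v)) F \<le> W * D"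
    unfolding L2_set_def using W_pos D
    by (intro real_le_lsqrt) (auto simp: power_mult_distrib)
qed (use ray_V in \<open>auto intro: path_vec_off\<close>)

text \<open>The sign reverses the index: multiplication by \<open>z\<close> raises frequencies,
  whereas the backward shift lowers the position on the path.\<close>

definition circle_vec :: "(complex \<Rightarrow> complex) \<Rightarrow> 'a \<Rightarrow> complex" where
  "circle_vec f = path_vec (\<lambda>k. fourier f (- k))"

text \<open>Bessel's inequality converts a uniform bound on the circle into a bound in
  \<open>l2 V\<close>.\<close>

lemma circle_vec_bound:
  assumes "continuous_on (sphere 0 1) f" "\<And>z. z \<in> sphere 0 1 \<Longrightarrow> cmod (f z) \<le> B"
  shows "circle_vec f \<in> l2 V \<and> l2_norm V (circle_vec f) \<le> W * B"
  unfolding circle_vec_def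
proof (rule path_vec_l2)
  show "B \<ge> 0" using assms(2)[of 1] norm_ge_zero[of "f 1"] by (simp del: norm_ge_zero)
  fix F :: "int set" assume F: "finite F"
  have "(\<Sum>k\<in>F. (cmod (fourier f (- k)))\<^sup>2) = (\<Sum>k\<in>uminus ` F. (cmod (fourier f k))\<^sup>2)"
    by (subst sum.reindex) auto
  also have "\<dots> \<le> B\<^sup>2" by (intro bessel assms) (use F in auto)
  finally show "(\<Sum>k\<in>F. (cmod (fourier f (- k)))\<^sup>2) \<le> B\<^sup>2" .
qed

lemma circle_vec_l2:
  assumes "continuous_on (sphere 0 1) f"
  shows "circle_vec f \<in> l2 V"
proof -
  have "bounded (f ` sphere 0 1)"
    by (intro compact_imp_bounded compact_continuous_image assms compact_sphere)
  then obtain B where "\<And>z. z \<in> sphere 0 1 \<Longrightarrow> cmod (f z) \<le> B"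
    unfolding bounded_iff by blast
  thus ?thesis using circle_vec_bound[OF assms] by blast
qed

lemma circle_vec_add:
  assumes "continuous_on (sphere 0 1) f" "continuous_on (sphere 0 1) g"
  shows "circle_vec (\<lambda>z. f z + g z) = circle_vec f + circle_vec g"
  by (auto simp: fun_eq_iff circle_vec_def path_vec_def fourier_add assms algebra_simps)

lemma circle_vec_cmult: "circle_vec (\<lambda>z. c * f z) = cscale c (circle_vec f)"
  by (auto simp: fun_eq_iff circle_vec_def path_vec_def fourier_cmult)

lemma circle_vec_diff:
  assumes "continuous_on (sphere 0 1) f" "continuous_on (sphere 0 1) g"
  shows "circle_vec (\<lambda>z. f z - g z) = circle_vec f - circle_vec g"
proof -
  have "circle_vec f = circle_vec (\<lambda>z. (f z - g z) + g z)" by simp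
  also have "\<dots> = circle_vec (\<lambda>z. f z - g z) + circle_vec g"
    by (intro circle_vec_add continuous_intros assms)
  finally show ?thesis by simp
qed

definition path_unit :: "int \<Rightarrow> 'a \<Rightarrow> complex" where
  "path_unit k = cscale (of_real (\<omega> k)) (delta (ray k))"

lemma path_unit_l2: "path_unit k \<in> l2 V"
  by (simp add: path_unit_def l2_cscale delta_l2 ray_V)

lemma path_unit_eq: "path_unit k = circle_vec (\<lambda>z. z powi (- k))"
proof
  fix v show "path_unit k v = circle_vec (\<lambda>z. z powi (- k)) v"
  proof (cases "v \<in> range ray")
    case True
    then obtain j where "v = ray j" by auto
    thus ?thesis using inj_ray by (auto simp: path_unit_def circle_vec_def fourier_powi delta_def inj_def)
  next
    case False
    thus ?thesis by (auto simp: circle_vec_def path_vec_off path_unit_def delta_def)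
  qed
qed

end

locale path_shift = path_operator +
  assumes A_path_vec: "A (path_vec b) = path_vec (\<lambda>k. b (k + 1))"
begin

lemma A_circle_vec:
  assumes "continuous_on (sphere 0 1) f"
  shows "A (circle_vec f) = circle_vec (\<lambda>z. z * f z)"
  unfolding circle_vec_def A_path_vec by (simp add: fourier_mult_z assms)

lemma A_path_unit: "A (path_unit k) = path_unit (k - 1)"
proof -
  have "A (path_unit k) = circle_vec (\<lambda>z. z * z powi (- k))"
    unfolding path_unit_eq by (intro A_circle_vec continuous_intros) auto
  also have "\<dots> = path_unit (k - 1)"
    unfolding path_unit_eq circle_vec_def
  proof (intro arg_cong[of _ _ path_vec] ext)
    fix j
    have "fourier (\<lambda>z. z * z powi - k) (- j) = fourier (\<lambda>z. z powi - k) (- j - 1)"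
      by (intro fourier_mult_z continuous_intros) auto
    thus "fourier (\<lambda>z. z * z powi - k) (- j) = fourier (\<lambda>z. z powi - (k - 1)) (- j)"
      by (auto simp: fourier_powi)
  qed
  finally show ?thesis .
qed

lemma pow_path_unit: "(A ^^ m) (path_unit (k + int m)) = path_unit k"
  by (induction m arbitrary: k) (simp_all add: funpow_Suc_right A_path_unit add.assoc del: funpow.simps(2))

text \<open>Under \<open>circle_vec\<close> polynomials in \<open>A\<close> become multiplication
  operators, which carries approximation on the circle over to orbits of \<open>A\<close>.\<close>

lemma papp_circle_vec:
  assumes "continuous_on (sphere 0 1) f"
  shows "papp p (circle_vec f) = circle_vec (\<lambda>z. poly p z * f z)"
proof (induction p)
  case 0
  show ?case using circle_vec_cmult[of 0 f] by simp
next
  case (pCons a p)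
  have "papp (pCons a p) (circle_vec f) = cscale a (circle_vec f) + circle_vec (\<lambda>z. z * (poly p z * f z))"
    unfolding papp_pCons[OF circle_vec_l2[OF assms]] pCons.IH
    by (subst A_circle_vec) (auto intro!: continuous_intros assms)
  also have "\<dots> = circle_vec (\<lambda>z. a * f z + z * (poly p z * f z))"
    by (subst circle_vec_add) (auto intro!: continuous_intros assms simp: circle_vec_cmult)
  finally show ?case by (simp add: algebra_simps)
qed

lemma flat_vec_l2: "circle_vec flat \<in> l2 V"
  by (intro circle_vec_l2 continuous_on_flat)

text \<open>Repeated division by \<open>z\<close> keeps \<open>flat\<close> in
  \<open>flat_span\<close>; multiplying the approximation of \<open>flat / z^m\<close> by
  \<open>z^m\<close> does not change its error on the circle. This is the recurrence hypothesis of
  \<open>cyclic_criterion\<close>.\<close>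

lemma flat_vec_recurrent:
  assumes "\<epsilon> > 0"
  shows "\<exists>p. l2_norm V (circle_vec flat - (A ^^ m) (papp p (circle_vec flat))) < \<epsilon>"
proof -
  have eW: "\<epsilon> / (2 * W) > 0" using assms W_pos by simp
  have "(\<lambda>z. flat z / z ^ m) \<in> flat_span"
  proof (induction m)
    case 0
    show ?case using flat_span_flat by simp
  next
    case (Suc m)
    from flat_span_div_z[OF this] show ?case by (simp add: mult.commute)
  qed
  then obtain p where p: "\<And>z. z \<in> sphere 0 1 \<Longrightarrow> cmod (flat z / z ^ m - poly p z * flat z) < \<epsilon> / (2 * W)"
    using flat_spanD[OF _ eW] by blast
  have "(A ^^ m) (papp p (circle_vec flat)) = papp (monom 1 m * p) (circle_vec flat)"
    by (simp add: papp_mult papp_monom papp_l2 flat_vec_l2)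
  also have "\<dots> = circle_vec (\<lambda>z. poly (monom 1 m * p) z * flat z)"
    by (intro papp_circle_vec continuous_on_flat)
  finally have eq: "circle_vec flat - (A ^^ m) (papp p (circle_vec flat)) =
      circle_vec (\<lambda>z. flat z - poly (monom 1 m * p) z * flat z)"
    by (subst circle_vec_diff) (auto intro!: continuous_intros continuous_on_flat)
  have "l2_norm V (circle_vec (\<lambda>z. flat z - poly (monom 1 m * p) z * flat z)) \<le> W * (\<epsilon> / (2 * W))"
  proof (rule circle_vec_bound[THEN conjunct2])
    show "continuous_on (sphere 0 1) (\<lambda>z. flat z - poly (monom 1 m * p) z * flat z)"
      by (intro continuous_intros continuous_on_flat)
    fix z :: complex assume z: "z \<in> sphere 0 1"
    hence "z \<noteq> 0" by auto
    hence "flat z - poly (monom 1 m * p) z * flat z = z ^ m * (flat z / z ^ m - poly p z * flat z)"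
      by (simp add: poly_monom algebra_simps)
    hence "cmod (flat z - poly (monom 1 m * p) z * flat z) = cmod (flat z / z ^ m - poly p z * flat z)"
      using z by (simp add: norm_mult norm_power)
    thus "cmod (flat z - poly (monom 1 m * p) z * flat z) \<le> \<epsilon> / (2 * W)" using p[OF z] by simp
  qed
  also have "\<dots> < \<epsilon>" using W_pos assms by simp
  finally show ?thesis unfolding eq[symmetric] by blast
qed

text \<open>The function \<open>z powi (- k)\<close> is not in \<open>flat_span\<close>, since it does not vanish at \<open>1\<close>; subtracting an
  average of \<open>n\<close> monomials, of \<open>\<ell>\<^sup>2\<close> norm \<open>1 / sqrt n\<close>, removes this obstruction.\<close>

lemma path_unit_orbit_closure: "path_unit k \<in> orbit_closure (circle_vec flat)"
  unfolding orbit_closure_def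
proof (safe intro!: path_unit_l2)
  fix \<epsilon> :: real assume e: "\<epsilon> > 0"
  \<comment> \<open>Makes \<open>W / sqrt n\<close>, the bound for the vector of the average, less
    than \<open>\<epsilon> / 2\<close>.\<close>
  obtain n :: nat where n: "n > (2 * W / \<epsilon>)\<^sup>2" using reals_Archimedean2 by blast
  hence n0: "n > 0" by (metis gr0I not_less of_nat_0 zero_le_power2)
  define mono where "mono j = (\<lambda>z::complex. z powi (int j - k))" for j
  define avg where "avg z = of_real (1 / n) * (\<Sum>j<n. mono j z)" for z
  define f where "f z = z powi (- k) - avg z" for z
  have cm: "continuous_on (sphere 0 1) (mono j)" for j
    unfolding mono_def by (intro continuous_intros) auto
  have cavg: "continuous_on (sphere 0 1) avg"
    unfolding avg_def by (intro continuous_intros cm)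
  have cpow: "continuous_on (sphere 0 1) (\<lambda>z::complex. z powi (- k))"
    by (intro continuous_intros) auto
  have cf: "continuous_on (sphere 0 1) f"
    unfolding f_def by (intro continuous_intros cavg cpow)
  have "f 1 = 0" using n0 by (simp add: f_def avg_def mono_def)
  hence "f \<in> flat_span" by (rule flat_span_vanishing[OF cf])
  then obtain p where p: "\<And>z. z \<in> sphere 0 1 \<Longrightarrow> cmod (f z - poly p z * flat z) < \<epsilon> / (2 * W)"
    using flat_spanD[OF _ divide_pos_pos[OF e, of "2 * W"]] W_pos by auto
  have cr: "continuous_on (sphere 0 1) (\<lambda>z. f z - poly p z * flat z)"
    by (intro continuous_intros cf continuous_on_flat)
  \<comment> \<open>The average is small in \<open>l2 V\<close>, the middle term is small uniformly
    on the circle, and the last one belongs to the orbit.\<close>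
  have "path_unit k = circle_vec (\<lambda>z. avg z + ((f z - poly p z * flat z) + poly p z * flat z))"
    by (simp add: path_unit_eq f_def)
  also have "\<dots> = circle_vec avg + (circle_vec (\<lambda>z. f z - poly p z * flat z) + circle_vec (\<lambda>z. poly p z * flat z))"
    by (subst circle_vec_add circle_vec_add[OF cr], (intro continuous_intros cavg cf continuous_on_flat)+)+ simp
  finally have eq: "path_unit k - papp p (circle_vec flat) = circle_vec avg + circle_vec (\<lambda>z. f z - poly p z * flat z)"
    by (simp add: papp_circle_vec continuous_on_flat)
  have fs: "fourier (\<lambda>z. \<Sum>j<m. mono j z) i = (\<Sum>j<m. if i = int j - k then 1 else 0)" for m i
  proof (induction m)
    case 0
    show ?case by (simp add: fourier_def)
  next
    case (Suc m)
    have "fourier (\<lambda>z. (\<Sum>j<m. mono j z) + mono m z) i = fourier (\<lambda>z. \<Sum>j<m. mono j z) i + fourier (mono m) i"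
      by (intro fourier_add continuous_intros cm)
    also have "fourier (mono m) i = (if i = int m - k then 1 else 0)"
      unfolding mono_def by (rule fourier_powi)
    finally show ?case using Suc by simp
  qed
  \<comment> \<open>The path indices carrying the \<open>n\<close> averaged monomials, after the
    sign change in \<open>circle_vec\<close>.\<close>
  define S where "S = (\<lambda>j. k - int j) ` {..<n}"
  have avg_coeff: "(cmod (fourier avg (- i)))\<^sup>2 = (if i \<in> S then (1 / n)\<^sup>2 else 0)" for i
  proof -
    have "(\<Sum>j<n. if - i = int j - k then 1 else (0::complex)) = (\<Sum>j<n. if j = nat (k - i) \<and> i \<le> k then 1 else 0)"
      by (intro sum.cong) auto
    also have "\<dots> = (if i \<in> S then 1 else 0)"
    proof (cases "i \<in> S")
      case True
      then obtain j where "j < n" "i = k - int j" by (auto simp: S_def)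
      thus ?thesis using True by simp
    next
      case False
      have "nat (k - i) \<ge> n" if "i \<le> k"
      proof (rule ccontr)
        assume "\<not> nat (k - i) \<ge> n"
        hence "i \<in> S" unfolding S_def using that by (intro image_eqI[of _ _ "nat (k - i)"]) auto
        thus False using False by simp
      qed
      thus ?thesis using False by (intro trans[OF sum.neutral]) auto
    qed
    finally have "fourier avg (- i) = of_real (1 / n) * (if i \<in> S then 1 else 0)"
      unfolding avg_def fourier_cmult fs by simp
    thus ?thesis by (simp add: norm_divide)
  qed
  have "l2_norm V (circle_vec avg) \<le> W * sqrt (1 / n)"
    unfolding circle_vec_def
  proof (rule path_vec_l2[THEN conjunct2])
    fix F :: "int set" assume F: "finite F"
    have "(\<Sum>i\<in>F. (cmod (fourier avg (- i)))\<^sup>2) = (\<Sum>i\<in>F \<inter> S. (1 / n)\<^sup>2)"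
      unfolding avg_coeff using F by (subst sum.inter_restrict) auto
    also have "\<dots> = card (F \<inter> S) * (1 / n)\<^sup>2" by simp
    also have "\<dots> \<le> n * (1 / n)\<^sup>2"
    proof -
      have "card (F \<inter> S) \<le> card S" unfolding S_def by (intro card_mono) auto
      also have "\<dots> \<le> n" unfolding S_def using card_image_le[of "{..<n}"] by fastforce
      finally show ?thesis by (intro mult_right_mono) auto
    qed
    also have "\<dots> = (sqrt (1 / n))\<^sup>2" using n0 by (simp add: power2_eq_square)
    finally show "(\<Sum>i\<in>F. (cmod (fourier avg (- i)))\<^sup>2) \<le> (sqrt (1 / n))\<^sup>2" .
  qed simp
  also have "W * sqrt (1 / n) < \<epsilon> / 2"
  proof -
    have "2 * W / \<epsilon> < sqrt n" using n by (rule real_less_rsqrt)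
    thus ?thesis using e n0 by (simp add: field_simps real_sqrt_divide)
  qed
  finally have avg_small: "l2_norm V (circle_vec avg) < \<epsilon> / 2" .
  have r: "circle_vec (\<lambda>z. f z - poly p z * flat z) \<in> l2 V \<and>
      l2_norm V (circle_vec (\<lambda>z. f z - poly p z * flat z)) \<le> W * (\<epsilon> / (2 * W))"
    by (intro circle_vec_bound cr) (use p in \<open>auto simp: less_imp_le\<close>)
  have "l2_norm V (path_unit k - papp p (circle_vec flat)) \<le> l2_norm V (circle_vec avg) +
      l2_norm V (circle_vec (\<lambda>z. f z - poly p z * flat z))"
    unfolding eq using r circle_vec_l2[OF cavg] by (intro l2_add) auto
  also have "\<dots> < \<epsilon> / 2 + \<epsilon> / 2" using avg_small r W_pos by (intro add_less_le_mono) auto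
  finally show "\<exists>p. l2_norm V (path_unit k - papp p (circle_vec flat)) < \<epsilon>" by auto
qed

text \<open>If \<open>A^m\<close> sends \<open>delta v\<close> to a multiple of a path vector, it
  does the same to a suitable path unit located \<open>m\<close> places further on. Their difference
  lies in the generalized kernel, and the path unit lies in the orbit closure of
  \<open>circle_vec flat\<close>.\<close>

lemma cyclic_path:
  assumes V: "countable V"
    and reach: "\<And>v. v \<in> V \<Longrightarrow> \<exists>m c j. (A ^^ m) (delta v) = cscale c (delta (ray j))"
    and onto: "\<And>v N. v \<in> V \<Longrightarrow> \<exists>w\<in>l2 V. (A ^^ N) w = delta v"
  shows "cyclic_op V A"
proof (rule cyclic_criterion[OF V flat_vec_l2 flat_vec_recurrent])
  fix v assume v: "v \<in> V"
  obtain m c j where m: "(A ^^ m) (delta v) = cscale c (delta (ray j))" using reach[OF v] by blast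
  define a where "a = c / of_real (\<omega> j)"
  define yg where "yg = cscale a (path_unit (j + int m))"
  have yg: "yg \<in> orbit_closure (circle_vec flat)" "yg \<in> l2 V"
    unfolding yg_def by (intro orbit_closure_cscale path_unit_orbit_closure l2_cscale path_unit_l2)+
  have "(A ^^ m) yg = cscale c (delta (ray j))"
    unfolding yg_def pow_cscale[OF path_unit_l2] pow_path_unit
    using \<omega>_pos[of j] by (simp add: path_unit_def a_def)
  hence "(A ^^ m) (delta v - yg) = 0"
    using m by (simp add: pow_diff delta_l2 v yg)
  hence yk: "delta v - yg \<in> gen_kernel"
    unfolding gen_kernel_def using l2_diff(1)[OF delta_l2[OF v] yg(2)] by blast
  have "\<exists>w\<in>l2 V. (A ^^ N) w = delta v - yg" for N
  proof -
    obtain w where w: "w \<in> l2 V" "(A ^^ N) w = delta v" using onto[OF v] by blast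
    \<comment> \<open>Preimages of \<open>yg\<close> are found \<open>N\<close> places further along
      the path.\<close>
    have "(A ^^ N) (cscale a (path_unit (j + int m + int N))) = yg"
      by (simp only: pow_cscale path_unit_l2 pow_path_unit yg_def)
    hence "(A ^^ N) (w - cscale a (path_unit (j + int m + int N))) = delta v - yg"
      using w by (simp add: pow_diff l2_cscale path_unit_l2)
    thus ?thesis using l2_diff(1)[OF w(1) l2_cscale[OF path_unit_l2]] by blast
  qed
  with yg yk show "\<exists>yg yk. delta v = yg + yk \<and> yg \<in> orbit_closure (circle_vec flat) \<and>
        yk \<in> gen_kernel \<and> (\<forall>N. \<exists>w\<in>l2 V. (A ^^ N) w = yk)"
    by (intro exI[of _ yg] exI[of _ "delta v - yg"]) simp
qed

end

subsection \<open>Weighted shifts on trees\<close>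

definition wadj :: "('a \<times> 'a) set \<Rightarrow> ('a \<Rightarrow> real) \<Rightarrow> ('a \<Rightarrow> complex) \<Rightarrow> 'a \<Rightarrow> complex" where
  "wadj E lam f = (\<lambda>u. \<Sum>\<^sub>\<infinity>v\<in>Chi E u. of_real (lam v) * f v)"

lemma infsum_single:
  assumes "\<And>x. x \<in> A \<Longrightarrow> x \<noteq> a \<Longrightarrow> f x = 0"
  shows "infsum f A = (if a \<in> A then f a else 0)"
proof -
  have "infsum f A = infsum f (A \<inter> {a})"
    by (rule infsum_cong_neutral) (use assms in auto)
  thus ?thesis by auto
qed

lemma wshift_cscale: "wshift V E lam (cscale c f) = cscale c (wshift V E lam f)"
  by (auto simp: wshift_def fun_eq_iff)

lemma trancl_sequence:
  assumes "\<And>n::nat. (s n, s (Suc n)) \<in> E"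
  shows "(s i, s (i + Suc d)) \<in> E\<^sup>+"
  by (induction d) (use assms in \<open>auto intro: trancl_into_trancl\<close>)

locale weighted_tree =
  fixes V :: "'a set" and E :: "('a \<times> 'a) set" and lam :: "'a \<Rightarrow> real"
  assumes tree: "directed_tree V E"
    and adm: "admissible_weights V E lam"
    and contr: "is_contraction V (wshift V E lam)"
    and c1: "class_C1dot V (wshift V E lam)"
begin

abbreviation "T \<equiv> wshift V E lam"
abbreviation "A \<equiv> wadj E lam"

section \<open>Tree structure and the adjoint of the weighted shift\<close>

lemma edge_V: "(u, v) \<in> E \<Longrightarrow> u \<in> V \<and> v \<in> V"
  using tree by (auto simp: directed_tree_def)

lemma parent_unique: "(u, v) \<in> E \<Longrightarrow> (u', v) \<in> E \<Longrightarrow> u = u'"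
  using tree by (auto simp: directed_tree_def)

lemma acyclic_edges: "(u, u) \<notin> E\<^sup>+"
  using tree by (auto simp: directed_tree_def)

lemma connected: "u \<in> V \<Longrightarrow> v \<in> V \<Longrightarrow> (u, v) \<in> (E \<union> E\<inverse>)\<^sup>*"
  using tree by (auto simp: directed_tree_def)

lemma par_eq: "(u, v) \<in> E \<Longrightarrow> par E v = u"
  unfolding par_def by (rule the_equality) (auto intro: parent_unique)

lemma lam_pos: "(u, v) \<in> E \<Longrightarrow> lam v > 0"
  using adm edge_V unfolding admissible_weights_def has_parent_def by blast

text \<open>Cauchy-Schwarz over the children of \<open>u\<close>, first on finite subsets because
  \<open>u\<close> may have infinitely many children.\<close>

lemma wadj_bound:
  assumes f: "f \<in> l2 V" and M: "(\<lambda>v. (lam v)\<^sup>2) summable_on Chi E u" "(\<Sum>\<^sub>\<infinity>v\<in>Chi E u. (lam v)\<^sup>2) \<le> M"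
  shows "(\<lambda>v. cmod (of_real (lam v) * f v)) summable_on Chi E u"
    and "(cmod (A f u))\<^sup>2 \<le> M * (\<Sum>\<^sub>\<infinity>v\<in>Chi E u. (cmod (f v))\<^sup>2)"
proof -
  let ?S = "\<Sum>\<^sub>\<infinity>v\<in>Chi E u. (cmod (f v))\<^sup>2"
  have CV: "Chi E u \<subseteq> V" using edge_V by (auto simp: Chi_def)
  have sf: "(\<lambda>v. (cmod (f v))\<^sup>2) summable_on Chi E u"
    using f CV by (auto simp: l2_def intro: summable_on_subset_banach)
  have S0: "?S \<ge> 0" by (intro infsum_nonneg) auto
  have M0: "M \<ge> 0" using M(2) infsum_nonneg[of "Chi E u" "\<lambda>v. (lam v)\<^sup>2"] by auto
  have fin: "(\<Sum>v\<in>H. cmod (of_real (lam v) * f v)) \<le> sqrt M * sqrt ?S" if H: "finite H" "H \<subseteq> Chi E u" for H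
  proof -
    have "(\<Sum>v\<in>H. cmod (of_real (lam v) * f v)) = (\<Sum>v\<in>H. \<bar>lam v\<bar> * \<bar>cmod (f v)\<bar>)"
      by (simp add: norm_mult)
    also have "\<dots> \<le> L2_set lam H * L2_set (\<lambda>v. cmod (f v)) H" by (rule L2_set_mult_ineq)
    also have "\<dots> \<le> sqrt M * sqrt ?S"
    proof (rule mult_mono)
      show "L2_set lam H \<le> sqrt M" unfolding L2_set_def
        using finite_sum_le_infsum[OF M(1) H] M(2) by auto
      show "L2_set (\<lambda>v. cmod (f v)) H \<le> sqrt ?S" unfolding L2_set_def
        using finite_sum_le_infsum[OF sf H] by auto
    qed (use M0 in auto)
    finally show ?thesis .
  qed
  show abs: "(\<lambda>v. cmod (of_real (lam v) * f v)) summable_on Chi E u"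
    by (rule nonneg_bdd_above_summable_on) (auto simp: bdd_above_def intro!: exI[of _ "sqrt M * sqrt ?S"] fin)
  have "cmod (A f u) \<le> (\<Sum>\<^sub>\<infinity>v\<in>Chi E u. cmod (of_real (lam v) * f v))"
    unfolding wadj_def by (rule norm_infsum_bound[OF abs])
  also have "\<dots> \<le> sqrt M * sqrt ?S" by (rule infsum_le_finite_sums[OF abs fin])
  finally have "(cmod (A f u))\<^sup>2 \<le> (sqrt M * sqrt ?S)\<^sup>2" by (intro power_mono) auto
  thus "(cmod (A f u))\<^sup>2 \<le> M * ?S" using M0 S0 by (simp add: power_mult_distrib)
qed

text \<open>Parents are unique, so different vertices have disjoint sets of children; hence the
  local bounds of \<open>wadj_bound\<close> add up to a global one.\<close>

lemma sum_infsum_Chi: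
  fixes g :: "'a \<Rightarrow> real"
  assumes s: "g summable_on V" and F: "finite F"
  shows "(\<Sum>u\<in>F. infsum g (Chi E u)) = infsum g (\<Union>u\<in>F. Chi E u) \<and> (\<Union>u\<in>F. Chi E u) \<subseteq> V"
  using F
proof (induction F rule: finite_induct)
  case (insert u F)
  have sub: "Chi E u \<subseteq> V" "(\<Union>u\<in>F. Chi E u) \<subseteq> V" using edge_V by (auto simp: Chi_def)
  have "Chi E u \<inter> (\<Union>u\<in>F. Chi E u) = {}"
    using insert.hyps by (auto simp: Chi_def dest: parent_unique)
  hence "infsum g (Chi E u \<union> (\<Union>u\<in>F. Chi E u)) = infsum g (Chi E u) + infsum g (\<Union>u\<in>F. Chi E u)"
    by (intro infsum_Un_disjoint summable_on_subset_banach[OF s] sub)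
  thus ?case using insert sub by simp
qed auto

lemma l2_operator_wadj: "\<exists>C. l2_operator V A C"
proof -
  obtain M where M: "\<And>u. u \<in> V \<Longrightarrow> (\<lambda>v. (lam v)\<^sup>2) summable_on Chi E u"
    "\<And>u. u \<in> V \<Longrightarrow> (\<Sum>\<^sub>\<infinity>v\<in>Chi E u. (lam v)\<^sup>2) \<le> M"
    using adm unfolding admissible_weights_def by blast
  have off: "A f u = 0" if "u \<notin> V" for f u
  proof -
    have "Chi E u = {}" using that edge_V by (auto simp: Chi_def)
    thus ?thesis by (simp add: wadj_def)
  qed
  obtain u where "u \<in> V" using tree by (auto simp: directed_tree_def)
  hence M0: "M \<ge> 0" using M(2)[of u] infsum_nonneg[of "Chi E u" "\<lambda>v. (lam v)\<^sup>2"] by force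
  have bd: "A f \<in> l2 V \<and> l2_norm V (A f) \<le> sqrt M * l2_norm V f" if f: "f \<in> l2 V" for f
  proof (rule l2_boundI)
    fix F assume F: "finite F" "F \<subseteq> V"
    let ?g = "\<lambda>v. (cmod (f v))\<^sup>2"
    have s: "?g summable_on V" using f by (simp add: l2_def)
    have "(\<Sum>u\<in>F. (cmod (A f u))\<^sup>2) \<le> (\<Sum>u\<in>F. M * infsum ?g (Chi E u))"
      using F by (intro sum_mono wadj_bound f M) auto
    also have "\<dots> = M * infsum ?g (\<Union>u\<in>F. Chi E u)"
      using sum_infsum_Chi[OF s F(1)] by (simp add: sum_distrib_left[symmetric])
    also have "\<dots> \<le> M * infsum ?g V"
      using sum_infsum_Chi[OF s F(1)] M0
      by (intro mult_left_mono infsum_mono_neutral summable_on_subset_banach[OF s] s) auto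
    finally have "L2_set (\<lambda>v. cmod (A f v)) F \<le> sqrt (M * infsum ?g V)"
      unfolding L2_set_def by simp
    thus "L2_set (\<lambda>v. cmod (A f v)) F \<le> sqrt M * l2_norm V f"
      by (simp add: l2_norm_def real_sqrt_mult)
  qed (use off M0 in auto)
  have summ: "(\<lambda>v. of_real (lam v) * f v) summable_on Chi E u" if "f \<in> l2 V" for f u
  proof (cases "u \<in> V")
    case True
    show ?thesis using wadj_bound(1)[OF that M(1)[OF True] M(2)[OF True]] by (rule abs_summable_summable)
  next
    case False
    hence "Chi E u = {}" using edge_V by (auto simp: Chi_def)
    thus ?thesis by simp
  qed
  have "l2_operator V A (sqrt M)"
  proof
    fix f g :: "'a \<Rightarrow> complex" and c :: complex assume f: "f \<in> l2 V"
    show "A (cscale c f) = cscale c (A f)"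
      by (auto simp: fun_eq_iff wadj_def mult.left_commute[of _ c] infsum_cmult_right')
    assume g: "g \<in> l2 V"
    show "A (f + g) = A f + A g"
      using summ[OF f] summ[OF g] by (auto simp: fun_eq_iff wadj_def distrib_left infsum_add)
  qed (use bd M0 in auto)
  thus ?thesis ..
qed

text \<open>Both inner products are sums over edges, indexed by the child on one side and grouped by
  the parent on the other. Absolute summability justifies the regrouping.\<close>

lemma is_adjoint_wadj: "is_adjoint V T A"
  unfolding is_adjoint_def
proof (intro conjI ballI)
  obtain C where "l2_operator V A C" using l2_operator_wadj by blast
  then interpret l2_operator V A C .
  show "A g \<in> l2 V" if "g \<in> l2 V" for g by (rule A_l2[OF that])
  fix f g assume f: "f \<in> l2 V" and g: "g \<in> l2 V"
  define h where "h v = T f v * cnj (g v)" for v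
  have Tf: "T f \<in> l2 V" using contr f by (auto simp: is_contraction_def)
  have "(\<lambda>v. (cmod (T f v))\<^sup>2 + (cmod (g v))\<^sup>2) summable_on V"
    using Tf g by (intro summable_on_add) (auto simp: l2_def)
  hence "(\<lambda>v. cmod (h v)) summable_on V"
  proof (rule summable_on_comparison_test)
    fix v
    have "0 \<le> (cmod (T f v) - cmod (g v))\<^sup>2" by simp
    hence "2 * (cmod (T f v) * cmod (g v)) \<le> (cmod (T f v))\<^sup>2 + (cmod (g v))\<^sup>2"
      by (simp add: power2_diff)
    moreover have "0 \<le> cmod (T f v) * cmod (g v)" by simp
    ultimately show "cmod (h v) \<le> (cmod (T f v))\<^sup>2 + (cmod (g v))\<^sup>2"
      unfolding h_def norm_mult complex_mod_cnj by linarith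
  qed auto
  hence hV: "h summable_on V" by (rule abs_summable_summable)
  have SE: "Sigma V (Chi E) = E" using edge_V by (auto simp: Chi_def)
  \<comment> \<open>Unique parents: an edge is determined by its lower end.\<close>
  have inj: "inj_on snd E" by (auto simp: inj_on_def dest: parent_unique)
  have sub: "snd ` E \<subseteq> V" using edge_V by auto
  have "l2_inner V (T f) g = infsum h V" unfolding l2_inner_def h_def ..
  also have "\<dots> = infsum h (snd ` E)"
  proof (rule infsum_cong_neutral)
    fix v assume "v \<in> V - snd ` E"
    hence "\<not> has_parent E v" unfolding has_parent_def by (metis DiffD2 image_eqI snd_conv)
    thus "h v = 0" by (simp add: h_def wshift_def)
  next
    fix v assume "v \<in> snd ` E - V"
    thus "h v = 0" using sub by blast
  qed simp
  also have "\<dots> = infsum (h \<circ> snd) E" by (rule infsum_reindex[OF inj])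
  also have "\<dots> = (\<Sum>\<^sub>\<infinity>(u, v)\<in>Sigma V (Chi E). h v)" unfolding SE by (simp add: o_def case_prod_unfold)
  also have "\<dots> = (\<Sum>\<^sub>\<infinity>u\<in>V. \<Sum>\<^sub>\<infinity>v\<in>Chi E u. h v)"
  proof (rule infsum_Sigma'_banach[symmetric])
    have "(h \<circ> snd) summable_on E"
      using summable_on_reindex[OF inj, of h] summable_on_subset_banach[OF hV sub] by simp
    thus "(\<lambda>(u, v). h v) summable_on Sigma V (Chi E)" unfolding SE by (simp add: o_def case_prod_unfold)
  qed
  also have "\<dots> = (\<Sum>\<^sub>\<infinity>u\<in>V. f u * cnj (A g u))"
  proof (rule infsum_cong)
    fix u assume "u \<in> V"
    have "(\<Sum>\<^sub>\<infinity>v\<in>Chi E u. h v) = (\<Sum>\<^sub>\<infinity>v\<in>Chi E u. f u * cnj (of_real (lam v) * g v))"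
      by (rule infsum_cong) (use edge_V par_eq in \<open>auto simp: h_def wshift_def Chi_def has_parent_def\<close>)
    also have "\<dots> = f u * cnj (A g u)"
      by (simp only: infsum_cmult_right' infsum_cnj wadj_def)
    finally show "(\<Sum>\<^sub>\<infinity>v\<in>Chi E u. h v) = f u * cnj (A g u)" .
  qed
  finally show "l2_inner V (T f) g = l2_inner V f (A g)" by (simp add: l2_inner_def)
qed

lemma wadj_delta: "(u, v) \<in> E \<Longrightarrow> A (delta v) = cscale (of_real (lam v)) (delta u)"
proof
  fix w assume uv: "(u, v) \<in> E"
  have "A (delta v) w = (if v \<in> Chi E w then of_real (lam v) * delta v v else 0)"
    unfolding wadj_def by (rule infsum_single) (auto simp: delta_def)
  also have "v \<in> Chi E w \<longleftrightarrow> w = u" using uv by (auto simp: Chi_def dest: parent_unique)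
  finally show "A (delta v) w = cscale (of_real (lam v)) (delta u) w" by (simp add: delta_def)
qed

lemma wadj_delta_root: "\<not> has_parent E v \<Longrightarrow> A (delta v) = 0"
proof
  fix w assume "\<not> has_parent E v"
  hence "v \<notin> Chi E w" by (auto simp: Chi_def has_parent_def)
  moreover have "A (delta v) w = (if v \<in> Chi E w then of_real (lam v) * delta v v else 0)"
    unfolding wadj_def by (rule infsum_single) (auto simp: delta_def)
  ultimately show "A (delta v) w = 0 w" by simp
qed

section \<open>Consequences of contractivity and class \<open>C1\<close>\<close>

lemma wshift_delta: "T (delta u) v = (if (u, v) \<in> E then of_real (lam v) else 0)"
proof (cases "has_parent E v")
  case True
  then obtain w where w: "(w, v) \<in> E" by (auto simp: has_parent_def)
  hence "(u, v) \<in> E \<longleftrightarrow> u = w" by (auto dest: parent_unique)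
  thus ?thesis using True par_eq[OF w] edge_V[OF w] by (auto simp: wshift_def delta_def)
qed (auto simp: wshift_def has_parent_def)

lemma not_tendsto_0:
  assumes "u \<in> V"
  shows "\<not> (\<lambda>n. l2_norm V ((T ^^ n) (delta u))) \<longlonglongrightarrow> 0"
proof -
  have "delta u \<noteq> (\<lambda>_. 0)" by (auto simp: delta_def fun_eq_iff)
  thus ?thesis using c1 delta_l2[OF assms] unfolding class_C1dot_def by blast
qed

text \<open>The shift kills the unit vector at a leaf, contrary to class \<open>C1\<close>.\<close>

lemma leafless:
  assumes "u \<in> V"
  shows "\<exists>v. (u, v) \<in> E"
proof (rule ccontr)
  assume "\<not> ?thesis"
  hence 0: "T (delta u) = 0" by (auto simp: fun_eq_iff wshift_delta)
  have "T 0 = 0" by (auto simp: fun_eq_iff wshift_def)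
  hence "(T ^^ n) 0 = 0" for n by (induction n) auto
  hence "(T ^^ Suc n) (delta u) = 0" for n by (simp add: funpow_Suc_right 0 del: funpow.simps)
  hence "(\<lambda>n. l2_norm V ((T ^^ Suc n) (delta u))) \<longlonglongrightarrow> 0" by (simp only: l2_zero tendsto_const)
  hence "(\<lambda>n. l2_norm V ((T ^^ n) (delta u))) \<longlonglongrightarrow> 0" by (subst (asm) filterlim_sequentially_Suc)
  thus False using not_tendsto_0[OF assms] by blast
qed

text \<open>The weight is a coordinate of the image of a unit vector under a contraction.\<close>

lemma lam_le_1:
  assumes "(u, v) \<in> E"
  shows "lam v \<le> 1"
proof -
  have u: "delta u \<in> l2 V" using edge_V[OF assms] by (simp add: delta_l2)
  have "cmod (T (delta u) v) \<le> l2_norm V (T (delta u))"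
    using contr u by (intro cmod_le_l2_norm) (auto simp: is_contraction_def)
  also have "\<dots> \<le> l2_norm V (delta u)"
    using contr u unfolding is_contraction_def by blast
  also have "\<dots> = 1" using edge_V[OF assms] by (simp add: l2_norm_delta)
  finally show ?thesis using assms lam_pos[OF assms] by (simp add: wshift_delta)
qed

text \<open>Move down to a child, which exists by \<open>leafless\<close>, and divide by its
  weight.\<close>

lemma onto:
  assumes "l2_operator V A C"
  shows "v \<in> V \<Longrightarrow> \<exists>w\<in>l2 V. (A ^^ N) w = delta v"
proof (induction N arbitrary: v)
  case 0
  thus ?case by (auto intro: bexI[of _ "delta v"] delta_l2)
next
  case (Suc N)
  interpret l2_operator V A C by fact
  obtain v' where e: "(v, v') \<in> E" using leafless[OF Suc.prems] by blast
  then obtain w where w: "w \<in> l2 V" "(A ^^ N) w = delta v'" using Suc.IH edge_V by blast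
  have "(A ^^ Suc N) (cscale (1 / of_real (lam v')) w) = A (cscale (1 / of_real (lam v')) (delta v'))"
    using w by (simp add: pow_cscale)
  also have "\<dots> = delta v"
    using lam_pos[OF e] edge_V[OF e] by (simp add: A_cscale delta_l2 wadj_delta[OF e])
  finally show ?case using w l2_cscale by blast
qed

text \<open>A summable family of positive numbers has a countable index set, so every vertex has
  countably many neighbours; by connectedness finitely many steps reach all of
  \<open>V\<close>.\<close>

lemma countable_V: "countable V"
proof -
  have cC: "countable (Chi E u)" if "u \<in> V" for u
  proof -
    have "(\<lambda>v. (lam v)\<^sup>2) summable_on Chi E u" using adm that by (auto simp: admissible_weights_def)
    hence "countable {v \<in> Chi E u. (lam v)\<^sup>2 \<noteq> 0}" by (rule summable_countable_real)
    moreover have "{v \<in> Chi E u. (lam v)\<^sup>2 \<noteq> 0} = Chi E u"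
      using lam_pos by (force simp: Chi_def)
    ultimately show ?thesis by simp
  qed
  let ?R = "E \<union> E\<inverse>"
  have cR: "countable (?R `` {u})" for u
  proof -
    have "?R `` {u} \<subseteq> Chi E u \<union> {par E u}" using par_eq by (auto simp: Chi_def)
    moreover have "countable (Chi E u)"
    proof (cases "u \<in> V")
      case False
      hence "Chi E u = {}" using edge_V by (auto simp: Chi_def)
      thus ?thesis by simp
    qed (rule cC)
    ultimately show ?thesis by (meson countable_Un countable_insert countable_empty countable_subset)
  qed
  obtain r where r: "r \<in> V" using tree by (auto simp: directed_tree_def)
  have cn: "countable ((?R ^^ n) `` {r})" for n
  proof (induction n)
    case (Suc n)
    have "(?R ^^ Suc n) `` {r} = (\<Union>u\<in>(?R ^^ n) `` {r}. ?R `` {u})" by auto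
    thus ?case using Suc cR by (metis countable_UN)
  qed auto
  have "V \<subseteq> (\<Union>n. (?R ^^ n) `` {r})"
    using connected[OF r] by (auto simp: rtrancl_power)
  thus ?thesis using cn by (meson countable_UN countable_subset countableI_type)
qed

text \<open>Follow an undirected path from \<open>r\<close>. A downward step preserves the ancestor
  \<open>x\<close>. An upward step also does, since parents are unique, unless it starts at
  \<open>x\<close> itself; then it ends in \<open>R\<close> by closedness.\<close>

lemma descends_from:
  assumes r: "r \<in> R" "r \<in> V" and v: "v \<in> V"
    and closed: "\<And>x y. x \<in> R \<Longrightarrow> (y, x) \<in> E \<Longrightarrow> y \<in> R"
  shows "\<exists>x\<in>R. (x, v) \<in> E\<^sup>*"
  using connected[OF r(2) v]
proof (induction rule: rtrancl_induct)
  case base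
  thus ?case using r by auto
next
  case (step y z)
  then obtain x where x: "x \<in> R" "(x, y) \<in> E\<^sup>*" by blast
  show ?case
  proof (cases "(y, z) \<in> E")
    case True
    thus ?thesis using x by (auto intro: rtrancl_into_rtrancl)
  next
    case False
    hence zy: "(z, y) \<in> E" using step by auto
    from x(2) show ?thesis
    proof (cases rule: rtranclE)
      case base
      thus ?thesis using closed[OF x(1)] zy by blast
    next
      case (step w)
      thus ?thesis using x parent_unique[OF zy] by blast
    qed
  qed
qed

lemma pow_delta_ancestor:
  assumes "l2_operator V A C" and "(u, v) \<in> E\<^sup>*" and "v \<in> V"
  shows "\<exists>m c. (A ^^ m) (delta v) = cscale c (delta u)"
  using assms(2,3)
proof (induction rule: rtrancl_induct)
  case base
  show ?case by (intro exI[of _ 0] exI[of _ 1]) simp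
next
  case (step y z)
  interpret l2_operator V A C by fact
  have y: "y \<in> V" using edge_V step by blast
  then obtain m c where mc: "(A ^^ m) (delta y) = cscale c (delta u)" using step by blast
  have "(A ^^ Suc m) (delta z) = cscale (of_real (lam z) * c) (delta u)"
    by (simp add: funpow_Suc_right wadj_delta[OF step(2)] pow_cscale delta_l2 y mc del: funpow.simps)
  thus ?case by blast
qed

text \<open>Every \<open>delta v\<close> is moved to the root and then killed, so it lies in the
  generalized kernel. The criterion applies with base vector 0 and \<open>yg = 0\<close>.\<close>

lemma cyclic_rooted:
  assumes "has_root V E"
  shows "cyclic_op V A"
proof -
  obtain C where C: "l2_operator V A C" using l2_operator_wadj by blast
  then interpret l2_operator V A C .
  obtain r where r: "r \<in> V" "\<not> has_parent E r" using assms by (auto simp: has_root_def is_root_def)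
  have gk: "delta v \<in> gen_kernel" if v: "v \<in> V" for v
  proof -
    have "(r, v) \<in> E\<^sup>*"
      using descends_from[of r "{r}" v] r v by (auto simp: has_parent_def)
    then obtain m c where "(A ^^ m) (delta v) = cscale c (delta r)" using pow_delta_ancestor[OF C _ v] by blast
    hence "(A ^^ Suc m) (delta v) = 0" using r by (simp add: A_cscale delta_l2 wadj_delta_root)
    thus ?thesis unfolding gen_kernel_def using delta_l2[OF v] by blast
  qed
  show ?thesis
  proof (rule cyclic_criterion[OF countable_V l2_zero(1)])
    show "\<exists>p. l2_norm V (0 - (A ^^ m) (papp p 0)) < \<epsilon>" if "\<epsilon> > 0" for m \<epsilon>
      unfolding papp_zero_right pow_zero diff_self l2_zero using that by blast
    fix v assume v: "v \<in> V"
    have "0 \<in> orbit_closure 0" using orbit_closure_papp[OF l2_zero(1), of 0] unfolding papp_0 .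
    thus "\<exists>yg yk. delta v = yg + yk \<and> yg \<in> orbit_closure 0 \<and> yk \<in> gen_kernel \<and> (\<forall>N. \<exists>w\<in>l2 V. (A ^^ N) w = yk)"
      using gk[OF v] onto[OF C v] by (intro exI[of _ 0] exI[of _ "delta v"]) simp
  qed
qed

end

section \<open>Rootless trees of finite branching index\<close>

lemma finite_branching:
  assumes "Br V E < \<infinity>"
  shows "finite {u \<in> V. \<not> is_leaf E u \<and> (\<nexists>v. Chi E u = {v})}" (is "finite ?B")
proof (rule ccontr)
  assume inf: "infinite ?B"
  obtain b where b: "Br V E = enat b" using assms by auto
  obtain F where F: "finite F" "card F = Suc b" "F \<subseteq> ?B"
    using infinite_arbitrarily_large[OF inf, of "Suc b"] by (elim exE conjE)
  \<comment> \<open>Each branching vertex contributes at least 1 to \<open>Br\<close>, so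
    \<open>b + 1\<close> of them exceed the value \<open>b\<close>.\<close>
  have one: "1 \<le> ecard (Chi E u) - 1" if "u \<in> ?B" for u
  proof (cases "finite (Chi E u)")
    case True
    have "card (Chi E u) \<noteq> 0" using that True by (auto simp: is_leaf_def)
    moreover have "card (Chi E u) \<noteq> 1" using that by (auto simp: card_1_singleton_iff)
    ultimately have "1 \<le> card (Chi E u) - 1" by linarith
    thus ?thesis using True by (simp add: ecard_def one_enat_def)
  qed (simp add: ecard_def)
  have "enat (Suc b) = (\<Sum>u\<in>F. 1)" using F(2) by (simp add: of_nat_eq_enat)
  also have "\<dots> \<le> (\<Sum>u\<in>F. ecard (Chi E u) - 1)" using F(3) one by (intro sum_mono) (rule one, rule subsetD)
  also have "\<dots> \<le> Br V E" unfolding Br_def using F by (intro SUP_upper) auto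
  finally show False unfolding b by simp
qed

context weighted_tree
begin

lemma edge_path_inj:
  assumes "\<And>k::int. (R k, R (k + 1)) \<in> E"
  shows "inj R"
proof (rule linorder_injI)
  fix i j :: int assume ij: "i < j"
  have e: "(R (i + int n), R (i + int (Suc n))) \<in> E" for n
    using assms[of "i + int n"] by (simp add: algebra_simps)
  have "(R (i + int 0), R (i + int (0 + Suc (nat (j - i - 1))))) \<in> E\<^sup>+"
    using trancl_sequence[of "\<lambda>n. R (i + int n)" E 0 "nat (j - i - 1)", OF e] .
  moreover have "i + int (0 + Suc (nat (j - i - 1))) = j" using ij by simp
  ultimately have "(R i, R j) \<in> E\<^sup>+" by simp
  thus "R i \<noteq> R j" using acyclic_edges by metis
qed

text \<open>A descending path chosen child by child never repeats a vertex, so it meets the finite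
  set of branching vertices only finitely often; an initial segment is dropped.\<close>

lemma unbranched_ray:
  assumes "Br V E < \<infinity>"
  shows "\<exists>s. \<forall>n::nat. Chi E (s n) = {s (Suc n)}"
proof -
  obtain ch where ch: "\<And>u. u \<in> V \<Longrightarrow> (u, ch u) \<in> E" using leafless by metis
  obtain r where r: "r \<in> V" using tree by (auto simp: directed_tree_def)
  define s where "s n = (ch ^^ n) r" for n
  have sV: "s n \<in> V" for n by (induction n) (use r ch edge_V in \<open>auto simp: s_def\<close>)
  have sE: "(s n, s (Suc n)) \<in> E" for n using ch[OF sV[of n]] by (simp add: s_def)
  have "inj s"
  proof (rule linorder_injI)
    fix i j :: nat assume "i < j"
    hence "(s i, s (i + Suc (j - i - 1))) \<in> E\<^sup>+" by (intro trancl_sequence sE)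
    thus "s i \<noteq> s j" using \<open>i < j\<close> acyclic_edges by auto
  qed
  define B where "B = {u \<in> V. \<not> is_leaf E u \<and> (\<nexists>v. Chi E u = {v})}"
  have "finite (s -` B)" unfolding B_def by (intro finite_vimageI finite_branching assms \<open>inj s\<close>)
  then obtain m where m: "s -` B \<subseteq> {..<m}" using finite_nat_bounded by blast
  have "Chi E (s (m + n)) = {s (m + Suc n)}" for n
  proof -
    have mem: "s (m + Suc n) \<in> Chi E (s (m + n))" using sE[of "m + n"] by (simp add: Chi_def)
    have "s (m + n) \<notin> B" using m by (auto simp: subset_iff)
    then obtain v where "Chi E (s (m + n)) = {v}"
      using mem sV[of "m + n"] unfolding B_def is_leaf_def by blast
    thus ?thesis using mem by simp
  qed
  thus ?thesis by (intro exI[of _ "\<lambda>n. s (m + n)"]) blast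
qed

lemma cyclic_rootless:
  assumes rootless: "\<not> has_root V E" and br: "Br V E < \<infinity>"
  shows "cyclic_op V A"
proof -
  obtain C where C: "l2_operator V A C" using l2_operator_wadj by blast
  then interpret l2_operator V A C .
  have parE: "(par E v, v) \<in> E" if "v \<in> V" for v
    using rootless that par_eq unfolding has_root_def is_root_def has_parent_def by blast
  obtain s where s: "\<And>n::nat. Chi E (s n) = {s (Suc n)}" using unbranched_ray[OF br] by blast
  have sE: "(s n, s (Suc n)) \<in> E" for n using s[of n] by (auto simp: Chi_def)
  \<comment> \<open>Downwards the ray follows \<open>s\<close>; upwards it follows parents, which
    exist because there is no root.\<close>
  define ray where "ray k = (if k \<ge> 0 then s (nat k) else (par E ^^ nat (- k)) (s 0))" for k :: int
  have anc_V: "(par E ^^ n) (s 0) \<in> V" for n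
    by (induction n) (use edge_V[OF sE[of 0]] edge_V parE in auto)
  have rayE: "(ray k, ray (k + 1)) \<in> E" for k
  proof (cases "k \<ge> 0")
    case True
    thus ?thesis using sE[of "nat k"] by (simp add: ray_def nat_add_distrib)
  next
    case False
    define n where "n = nat (- (k + 1))"
    have "nat (- k) = Suc n" using False by (simp add: n_def)
    moreover have "ray (k + 1) = (par E ^^ n) (s 0)"
      using False by (cases "k = - 1") (auto simp: ray_def n_def)
    ultimately show ?thesis using parE[OF anc_V[of n]] False by (simp add: ray_def)
  qed
  have rayV: "ray k \<in> V" for k using edge_V[OF rayE] by blast
  have inj: "inj ray" using rayE by (rule edge_path_inj)
  define l where "l k = lam (ray k)" for k
  have l: "0 < l k" "l k \<le> 1" for k
    using lam_pos[OF rayE[of "k - 1"]] lam_le_1[OF rayE[of "k - 1"]] by (auto simp: l_def)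
  define P where "P n = (\<Prod>i\<in>{1..int n}. l i)" for n :: nat
  have P0: "P n > 0" for n unfolding P_def using l by (intro prod_pos) auto
  have PSuc: "P (Suc n) = l (int (Suc n)) * P n" for n
  proof -
    have "{1..int (Suc n)} = insert (int (Suc n)) {1..int n}" by auto
    thus ?thesis by (simp add: P_def)
  qed
  \<comment> \<open>Without branching below \<open>s 0\<close> the image remains a multiple of a
    single unit vector, so its norm is exactly \<open>P n\<close>.\<close>
  have Tn: "(T ^^ n) (delta (s 0)) = cscale (of_real (P n)) (delta (s n))" for n
  proof (induction n)
    case 0
    show ?case by (simp add: P_def)
  next
    case (Suc n)
    have "T (delta (s n)) = cscale (of_real (l (int (Suc n)))) (delta (s (Suc n)))"
    proof
      fix v
      have "(s n, v) \<in> E \<longleftrightarrow> v = s (Suc n)" using s[of n] by (auto simp: Chi_def)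
      moreover have "ray (int (Suc n)) = s (Suc n)" by (simp add: ray_def nat_add_distrib)
      ultimately show "T (delta (s n)) v = cscale (of_real (l (int (Suc n)))) (delta (s (Suc n))) v"
        unfolding wshift_delta l_def by (simp add: delta_def)
    qed
    thus ?case by (simp only: funpow.simps comp_apply Suc wshift_cscale PSuc cscale_simps of_real_mult mult.commute)
  qed
  have "l2_norm V ((T ^^ n) (delta (s 0))) = P n" for n
    using P0[of n] edge_V[OF sE[of n]] by (simp add: Tn l2_norm_cscale l2_norm_delta)
  hence nP: "\<not> P \<longlonglongrightarrow> 0" using not_tendsto_0[of "s 0"] edge_V[OF sE[of 0]] by simp
  have dec: "decseq P"
    by (rule decseq_SucI) (use l P0 in \<open>auto simp: PSuc intro!: mult_left_le_one_le less_imp_le\<close>)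
  \<comment> \<open>A decreasing positive sequence that does not tend to 0 stays above a positive
    constant.\<close>
  have "\<exists>c>0. \<forall>n. c \<le> P n"
  proof (rule ccontr)
    assume no: "\<not> ?thesis"
    have "P \<longlonglongrightarrow> 0"
    proof (rule LIMSEQ_I)
      fix e :: real assume "e > 0"
      then obtain N where "P N < e" using no by (meson not_le)
      hence "norm (P n - 0) < e" if "n \<ge> N" for n
        using decseqD[OF dec that] P0[of n] by simp
      thus "\<exists>N. \<forall>n\<ge>N. norm (P n - 0) < e" by blast
    qed
    thus False using nP by blast
  qed
  then obtain c where c: "c > 0" "\<And>n. c \<le> P n" by blast
  \<comment> \<open>The solution of \<open>l (k + 1) * \<omega> (k + 1) = \<omega> k\<close> with
    \<open>\<omega> 0 = 1\<close>. For each \<open>k\<close> at least one of the two products is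
    empty; for \<open>k \<ge> 0\<close> the bound \<open>1 / c\<close> applies, and for negative
    \<open>k\<close> the bound 1, since weights are at most 1.\<close>
  define \<omega> where "\<omega> k = (\<Prod>i\<in>{k+1..0}. l i) / (\<Prod>i\<in>{1..k}. l i)" for k
  have \<omega>_pos: "0 < \<omega> k" for k unfolding \<omega>_def using l by (intro divide_pos_pos prod_pos) auto
  have \<omega>_rec: "l (k + 1) * \<omega> (k + 1) = \<omega> k" for k
  proof (cases "k \<ge> 0")
    case True
    hence "{1..k+1} = insert (k+1) {1..k}" by auto
    thus ?thesis using True l(1)[of "k+1"] by (simp add: \<omega>_def)
  next
    case False
    hence "{k+1..0} = insert (k+1) {k+1+1..0}" by auto
    hence "(\<Prod>i\<in>{k+1..0}. l i) = l (k+1) * (\<Prod>i\<in>{k+1+1..0}. l i)" by simp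
    thus ?thesis using False by (simp add: \<omega>_def)
  qed
  have \<omega>_le: "\<omega> k \<le> max 1 (1 / c)" for k
  proof (cases "k \<ge> 0")
    case True
    hence "\<omega> k = 1 / P (nat k)" by (simp add: \<omega>_def P_def)
    also have "\<dots> \<le> 1 / c" using c(1) c(2)[of "nat k"] by (intro divide_left_mono mult_pos_pos P0) auto
    finally show ?thesis by simp
  next
    case False
    hence "\<omega> k = (\<Prod>i\<in>{k+1..0}. l i)" by (simp add: \<omega>_def)
    also have "\<dots> \<le> 1" using l by (intro prod_le_1) (auto intro: less_imp_le)
    finally show ?thesis by simp
  qed
  interpret path_operator V A C ray \<omega> "max 1 (1 / c)"
    by unfold_locales (rule inj rayV \<omega>_pos \<omega>_le)+
  \<comment> \<open>A vertex on the ray has exactly one child on it and a vertex off the ray has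
    none, so the sum over children has at most one nonzero term even where the upper part of the ray
    branches.\<close>
  have shift: "A (path_vec b) = path_vec (\<lambda>k. b (k + 1))" for b
  proof
    fix u
    have child: "u = ray (j - 1)" if "(u, ray j) \<in> E" for j
      using parent_unique[OF that] rayE[of "j - 1"] by simp
    show "A (path_vec b) u = path_vec (\<lambda>k. b (k + 1)) u"
    proof (cases "u \<in> range ray")
      case True
      then obtain k where k: "u = ray k" by auto
      have "path_vec b v = 0" if "v \<in> Chi E u" "v \<noteq> ray (k + 1)" for v
      proof (rule path_vec_off, rule notI)
        assume "v \<in> range ray"
        then obtain j where j: "v = ray j" by auto
        hence "ray k = ray (j - 1)" using that child[of j] k by (simp add: Chi_def)
        hence "k = j - 1" using inj by (simp add: inj_def)
        thus False using that j by simp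
      qed
      hence "A (path_vec b) u = (if ray (k + 1) \<in> Chi E u then of_real (lam (ray (k + 1))) * path_vec b (ray (k + 1)) else 0)"
        unfolding wadj_def by (intro infsum_single) simp
      also have "\<dots> = of_real (l (k + 1) * \<omega> (k + 1)) * b (k + 1)"
        using rayE[of k] by (simp add: Chi_def k l_def)
      finally show ?thesis unfolding \<omega>_rec k by simp
    next
      case False
      have "path_vec b v = 0" if "v \<in> Chi E u" for v
        using False that child by (intro path_vec_off) (auto simp: Chi_def)
      hence "A (path_vec b) u = 0" unfolding wadj_def by (intro infsum_0) simp
      thus ?thesis using False by (simp add: path_vec_off)
    qed
  qed
  interpret path_shift V A C ray \<omega> "max 1 (1 / c)"
    by unfold_locales (rule shift)
  show ?thesis
  proof (rule cyclic_path[OF countable_V])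
    fix v assume v: "v \<in> V"
    \<comment> \<open>The ray extends upwards without end, so its range is closed under parents and
      every vertex descends from it.\<close>
    have "\<exists>x\<in>range ray. (x, v) \<in> E\<^sup>*"
    proof (rule descends_from[of "ray 0"])
      fix x y assume "x \<in> range ray" "(y, x) \<in> E"
      then obtain k where "(y, ray k) \<in> E" by auto
      hence "y = ray (k - 1)" using parent_unique rayE[of "k - 1"] by simp
      thus "y \<in> range ray" by simp
    qed (use v rayV in auto)
    then obtain j where "(ray j, v) \<in> E\<^sup>*" by blast
    thus "\<exists>m c j. (A ^^ m) (delta v) = cscale c (delta (ray j))"
      using pow_delta_ancestor[OF C _ v] by blast
    show "\<exists>w\<in>l2 V. (A ^^ N) w = delta v" for N by (rule onto[OF C v])
  qed
qed

end

theorem mainTheorem18: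
  fixes V :: "'a set" and E :: "('a \<times> 'a) set" and lam :: "'a \<Rightarrow> real"
  assumes "directed_tree V E"
    and "admissible_weights V E lam"
    and "is_contraction V (wshift V E lam)"
    and "class_C1dot V (wshift V E lam)"
  shows "(has_root V E \<longrightarrow>
            (\<exists>T'. is_adjoint V (wshift V E lam) T' \<and> cyclic_op V T'))
       \<and> ((\<not> has_root V E \<and> Br V E < \<infinity>) \<longrightarrow>
            (\<exists>T'. is_adjoint V (wshift V E lam) T' \<and> cyclic_op V T'))"
proof -
  interpret weighted_tree V E lam by (rule weighted_tree.intro) fact+
  show ?thesis using is_adjoint_wadj cyclic_rooted cyclic_rootless by blast
qed

end
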